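(* Let $X$ be a compact Hausdorff space. The Hilbert $C(X)$-module $l_2(C(X))$ is not $C^*$-reflexive if and only if there exists a sequence $\{U_k\}_{k\in\mathbb N}$ of non-empty, pairwise disjoint open subsets of $X$ such that $\prod_k C_0(U_k)$ is canonically included into $C(X)$.
   Context: For a $C^*$-algebra $A$, $l_2(A)$ is the right Hilbert $A$-module of sequences $(a_i)$ in $A$ with $\sum_i a_i^*a_i$ norm convergent, inner product $\langle a,b\rangle=\sum_i a_i^*b_i$. For a Hilbert $A$-module $M$, $M'$ is the module of bounded $A$-module maps $M\to A$ and $M''=(M')'$ (Paschke's conventions); there is a canonical isometric inclusion $M\subseteq M''$, and $M$ is $C^*$-reflexive if $M''=M$. For an open $U\subseteq X$, $C_0(U)$ is identified with the ideal of functions in $C(X)$ vanishing on $X\setminus U$. For pairwise disjoint open $U_k$, $\prod_k C_0(U_k)$ is the $C^*$-algebra of bounded sequences $(\lambda_k)$, $\lambda_k\in C_0(U_k)$, with sup norm. We say $\prod_kC_0(U_k)$ is canonically included into $C(X)$ if the canonical inclusion $\bigoplus_kC_0(U_k)\subseteq C(X)$ extends to an inclusion of $\prod_kC_0(U_k)$, i.e. for every bounded sequence $(\lambda_k)$, $\lambda_k\in C_0(U_k)$, there is a (necessarily unique) continuous function on $X$ which equals $\lambda_k$ on each $U_k$ and vanishes on $X\setminus\overline{\bigcup_k U_k}$. *)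

theory Defs
  imports "HOL-Analysis.Analysis"
begin

text \<open>The compact Hausdorff space X is the type 'a (class t2_space, with UNIV compact).
 C(X) is represented by continuous functions 'a => complex.\<close>

definition CX :: "('a::topological_space \<Rightarrow> complex) set" where
  "CX = {f. continuous_on UNIV f}"

definition supnorm :: "('a \<Rightarrow> complex) \<Rightarrow> real" where
  "supnorm f = Sup (range (\<lambda>x. cmod (f x)))"

definition l2CX :: "(nat \<Rightarrow> 'a::topological_space \<Rightarrow> complex) set" where
  "l2CX = {a. (\<forall>i. a i \<in> CX) \<and>
     (\<exists>s \<in> CX. uniform_limit UNIV (\<lambda>n x. \<Sum>i<n. cnj (a i x) * a i x) s sequentially)}"

definition l2_inner :: "(nat \<Rightarrow> 'a \<Rightarrow> complex) \<Rightarrow> (nat \<Rightarrow> 'a \<Rightarrow> complex) \<Rightarrow> 'a \<Rightarrow> complex" where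
  "l2_inner a b = (\<lambda>x. \<Sum>i. cnj (a i x) * b i x)"

definition l2_mnorm :: "(nat \<Rightarrow> 'a \<Rightarrow> complex) \<Rightarrow> real" where
  "l2_mnorm a = sqrt (supnorm (l2_inner a a))"

definition l2_act :: "(nat \<Rightarrow> 'a \<Rightarrow> complex) \<Rightarrow> ('a \<Rightarrow> complex) \<Rightarrow> (nat \<Rightarrow> 'a \<Rightarrow> complex)" where
  "l2_act a l = (\<lambda>i x. a i x * l x)"

definition l2_dual :: "((nat \<Rightarrow> 'a::topological_space \<Rightarrow> complex) \<Rightarrow> ('a \<Rightarrow> complex)) set" where
  "l2_dual = {T. (\<forall>a\<in>l2CX. T a \<in> CX) \<and> (\<forall>a. a \<notin> l2CX \<longrightarrow> T a = (\<lambda>x. 0)) \<and>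
     (\<forall>a\<in>l2CX. \<forall>b\<in>l2CX. T (\<lambda>i x. a i x + b i x) = (\<lambda>x. T a x + T b x)) \<and>
     (\<forall>a\<in>l2CX. \<forall>l\<in>CX. T (l2_act a l) = (\<lambda>x. T a x * l x)) \<and>
     (\<exists>C. \<forall>a\<in>l2CX. supnorm (T a) \<le> C * l2_mnorm a)}"

text \<open>Paschke's right module structure on M': (T . l)(a) = l^* T(a); and the norm of M'.\<close>
definition dual_act :: "(('b \<Rightarrow> ('a \<Rightarrow> complex))) \<Rightarrow> ('a \<Rightarrow> complex) \<Rightarrow> ('b \<Rightarrow> ('a \<Rightarrow> complex))" where
  "dual_act T l = (\<lambda>a x. cnj (l x) * T a x)"

definition dual_norm :: "((nat \<Rightarrow> 'a::topological_space \<Rightarrow> complex) \<Rightarrow> ('a \<Rightarrow> complex)) \<Rightarrow> real" where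
  "dual_norm T = Sup ((\<lambda>a. supnorm (T a)) ` {a \<in> l2CX. l2_mnorm a \<le> 1})"

definition l2_bidual ::
  "((((nat \<Rightarrow> 'a::topological_space \<Rightarrow> complex) \<Rightarrow> ('a \<Rightarrow> complex))) \<Rightarrow> ('a \<Rightarrow> complex)) set" where
  "l2_bidual = {\<Phi>. (\<forall>T\<in>l2_dual. \<Phi> T \<in> CX) \<and> (\<forall>T. T \<notin> l2_dual \<longrightarrow> \<Phi> T = (\<lambda>x. 0)) \<and>
     (\<forall>T\<in>l2_dual. \<forall>S\<in>l2_dual. \<Phi> (\<lambda>a x. T a x + S a x) = (\<lambda>x. \<Phi> T x + \<Phi> S x)) \<and>
     (\<forall>T\<in>l2_dual. \<forall>l\<in>CX. \<Phi> (dual_act T l) = (\<lambda>x. \<Phi> T x * l x)) \<and>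
     (\<exists>C. \<forall>T\<in>l2_dual. supnorm (\<Phi> T) \<le> C * dual_norm T)}"

definition l2_hat ::
  "(nat \<Rightarrow> 'a::topological_space \<Rightarrow> complex) \<Rightarrow> (((nat \<Rightarrow> 'a \<Rightarrow> complex) \<Rightarrow> ('a \<Rightarrow> complex))) \<Rightarrow> ('a \<Rightarrow> complex)" where
  "l2_hat a = (\<lambda>T. if T \<in> l2_dual then (\<lambda>x. cnj (T a x)) else (\<lambda>x. 0))"

definition l2CX_reflexive :: "'a::topological_space itself \<Rightarrow> bool" where
  "l2CX_reflexive _ \<longleftrightarrow> (l2_bidual :: ((((nat \<Rightarrow> 'a \<Rightarrow> complex) \<Rightarrow> ('a \<Rightarrow> complex))) \<Rightarrow> ('a \<Rightarrow> complex)) set)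
       = l2_hat ` (l2CX :: (nat \<Rightarrow> 'a \<Rightarrow> complex) set)"

text \<open>C_0(U) as an ideal of C(X).\<close>
definition C0 :: "'a::topological_space set \<Rightarrow> ('a \<Rightarrow> complex) set" where
  "C0 U = {f \<in> CX. \<forall>x. x \<notin> U \<longrightarrow> f x = 0}"

definition prod_canon_included :: "(nat \<Rightarrow> 'a::topological_space set) \<Rightarrow> bool" where
  "prod_canon_included U \<longleftrightarrow>
     (\<forall>lam :: nat \<Rightarrow> 'a \<Rightarrow> complex. (\<forall>k. lam k \<in> C0 (U k)) \<and> (\<exists>B. \<forall>k x. cmod (lam k x) \<le> B) \<longrightarrow>
        (\<exists>f \<in> CX. (\<forall>k. \<forall>x\<in>U k. f x = lam k x) \<and> (\<forall>x. x \<notin> closure (\<Union>k. U k) \<longrightarrow> f x = 0)))"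

end

theory Submission
  imports Defs
begin

text \<open>
  A bounded functional on \<open>l2(C(X))\<close> is a sequence \<open>t\<close> of continuous functions with bounded square
  sums, and an element \<open>\<Phi>\<close> of the bidual is governed by its values \<open>g\<^sub>i\<close> on the coordinate
  functionals, which again have bounded square sums. If \<open>g\<close> lies in \<open>l2(C(X))\<close>, then \<open>\<Phi>\<close> is the
  evaluation at \<open>cnj g\<close>: every nonempty open set contains an open set on which the tail of \<open>t\<close> is
  small, and \<open>\<Phi>\<close> acts locally. Otherwise there are disjoint finite blocks of indices whose block
  sums of \<open>|g\<^sub>i|\<^sup>2\<close> exceed a fixed \<open>e > 0\<close> on nonempty open sets. Each point lies in boundedly many
  of these sets, so infinitely many of them contain pairwise disjoint nonempty open subsets
  \<open>U\<^sub>k\<close>. The extension of a bounded sequence \<open>lam\<^sub>k\<close> in \<open>C\<^sub>0(U\<^sub>k)\<close> is the value of \<open>\<Phi>\<close> at the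
  functional whose coefficients on the k-th block are \<open>cnj lam\<^sub>k * g\<^sub>i\<close> divided by the block sum.

  Conversely, given \<open>U\<^sub>k\<close> and bump functions \<open>lam\<^sub>k\<close> supported in \<open>U\<^sub>k\<close>, sending \<open>T\<close> to the extension
  of \<open>lam\<^sub>k * cnj (T e\<^sub>k)\<close> is an element of the bidual that could only come from the sequence
  \<open>lam\<close>, which is not in \<open>l2(C(X))\<close>.
\<close>

subsection \<open>Continuous functions and the supremum norm\<close>

lemma CX_const: "(\<lambda>x. c) \<in> CX"
  and CX_add: "f \<in> CX \<Longrightarrow> g \<in> CX \<Longrightarrow> (\<lambda>x. f x + g x) \<in> CX"
  and CX_mult: "f \<in> CX \<Longrightarrow> g \<in> CX \<Longrightarrow> (\<lambda>x. f x * g x) \<in> CX"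
  and CX_cnj: "f \<in> CX \<Longrightarrow> (\<lambda>x. cnj (f x)) \<in> CX"
  and CX_of_real: "continuous_on UNIV h \<Longrightarrow> (\<lambda>x. complex_of_real (h x)) \<in> CX"
  by (auto simp: CX_def intro!: continuous_intros)

lemma continuous_on_sqsum:
  assumes "\<And>i. t i \<in> CX"
  shows "continuous_on UNIV (\<lambda>x. \<Sum>i\<in>I. (cmod (t i x))\<^sup>2)"
  using assms by (auto simp: CX_def intro!: continuous_intros)

lemma bdd_above_cmod_CX:
  assumes "compact (UNIV :: 'a::topological_space set)" and "(f :: 'a \<Rightarrow> complex) \<in> CX"
  shows "bdd_above (range (\<lambda>x. cmod (f x)))"
proof -
  have "compact (range (\<lambda>x. cmod (f x)))"
    using assms by (intro compact_continuous_image) (auto simp: CX_def intro!: continuous_intros)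
  then show ?thesis
    by (rule bounded_imp_bdd_above[OF compact_imp_bounded])
qed

lemma supnorm_upper:
  assumes "compact (UNIV :: 'a::topological_space set)" and "(f :: 'a \<Rightarrow> complex) \<in> CX"
  shows "cmod (f x) \<le> supnorm f"
  unfolding supnorm_def using bdd_above_cmod_CX[OF assms] by (auto intro: cSUP_upper)

lemma supnorm_least: "(\<And>x. cmod (f x) \<le> b) \<Longrightarrow> supnorm f \<le> b"
  unfolding supnorm_def by (rule cSUP_least) auto

text \<open>A compact Hausdorff space is locally compact and regular, hence completely regular. The
  separating function obtained there is 0 at \<open>x\<close> and 1 off \<open>W\<close>, so the
  bump is its complement to 1.\<close>

lemma urysohn_bump:
  fixes x :: "'a::t2_space"
  assumes "compact (UNIV :: 'a set)" "open W" "x \<in> W"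
  obtains l :: "'a \<Rightarrow> real" where "continuous_on UNIV l" "\<And>y. 0 \<le> l y" "\<And>y. l y \<le> 1"
    "l x = 1" "\<And>y. y \<notin> W \<Longrightarrow> l y = 0"
proof -
  have c: "compact_space (euclidean :: 'a topology)"
    by (simp add: assms(1) compact_space_def)
  have h: "Hausdorff_space (euclidean :: 'a topology)"
    unfolding Hausdorff_space_def disjnt_def by (metis hausdorff open_openin topspace_euclidean)
  have "completely_regular_space (euclidean :: 'a topology)"
    using c h by (intro locally_compact_regular_imp_completely_regular_space)
      (auto intro: compact_imp_locally_compact_space compact_Hausdorff_imp_regular_space)
  moreover have "closedin euclidean (- W)" "x \<in> topspace euclidean - (- W)"
    using assms by auto
  ultimately obtain f :: "'a \<Rightarrow> real" where f: "continuous_map euclidean (top_of_set {0..1}) f"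
    "f x = 0" "f ` (- W) \<subseteq> {1}"
    unfolding completely_regular_space_def by blast
  have f1: "continuous_on UNIV f" "\<And>y. f y \<in> {0..1}"
    using f(1) by (auto simp: continuous_map_in_subtopology)
  show ?thesis
  proof (rule that[of "\<lambda>y. 1 - f y"])
    show "continuous_on UNIV (\<lambda>y. 1 - f y)" using f1(1) by (intro continuous_intros)
  qed (use f f1(2) in \<open>auto\<close>)
qed

subsection \<open>Square-summable sequences\<close>

text \<open>Two partial sums differ by the block between them, so this is the Cauchy criterion;
  completeness supplies the limit. It reduces convergence questions to estimates on blocks.\<close>

lemma uniformly_convergent_sum_iff:
  fixes q :: "nat \<Rightarrow> 'a \<Rightarrow> 'b::banach"
  shows "uniformly_convergent_on UNIV (\<lambda>n x. \<Sum>i<n. q i x) \<longleftrightarrow>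
    (\<forall>e>0. \<exists>N. \<forall>m\<ge>N. \<forall>n\<ge>m. \<forall>x. norm (\<Sum>i=m..<n. q i x) < e)" (is "?L \<longleftrightarrow> ?R")
proof -
  have d: "dist (\<Sum>i<m. q i x) (\<Sum>i<n. q i x) = norm (\<Sum>i=m..<n. q i x)" if "m \<le> n" for m n x
    using sum_diff_nat_ivl[of 0 m n "\<lambda>i. q i x"] that
    by (subst dist_commute) (simp add: dist_norm atLeast0LessThan)
  show ?thesis
  proof
    assume ?L
    show ?R
    proof (intro allI impI)
      fix e :: real
      assume "e > 0"
      then obtain N where N: "\<And>x m n. m \<ge> N \<Longrightarrow> n \<ge> N \<Longrightarrow> dist (\<Sum>i<m. q i x) (\<Sum>i<n. q i x) < e"
        using \<open>?L\<close> unfolding uniformly_convergent_eq_Cauchy uniformly_Cauchy_on_def by blast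
      have "norm (\<Sum>i=m..<n. q i x) < e" if "m \<ge> N" "n \<ge> m" for m n x
        using N[of m n x] d[of m n x] that by simp
      then show "\<exists>N. \<forall>m\<ge>N. \<forall>n\<ge>m. \<forall>x. norm (\<Sum>i=m..<n. q i x) < e"
        by blast
    qed
  next
    assume R: ?R
    show ?L
      unfolding uniformly_convergent_eq_Cauchy
    proof (rule uniformly_Cauchy_onI')
      fix e :: real
      assume "e > 0"
      then obtain N where N: "\<And>m n x. m \<ge> N \<Longrightarrow> n \<ge> m \<Longrightarrow> norm (\<Sum>i=m..<n. q i x) < e"
        using R by blast
      show "\<exists>M. \<forall>x\<in>UNIV. \<forall>m\<ge>M. \<forall>n>m. dist (\<Sum>i<m. q i x) (\<Sum>i<n. q i x) < e"
        using N d by (intro exI[of _ N]) auto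
    qed
  qed
qed

lemma CX_uniform_limit:
  assumes "uniformly_convergent_on UNIV (\<lambda>n x. \<Sum>i<n. q i x)" "\<And>i. q i \<in> CX"
  shows "(\<lambda>x. \<Sum>i. q i x) \<in> CX" "uniform_limit UNIV (\<lambda>n x. \<Sum>i<n. q i x) (\<lambda>x. \<Sum>i. q i x) sequentially"
    "summable (\<lambda>i. q i x)"
proof -
  obtain s where s: "uniform_limit UNIV (\<lambda>n x. \<Sum>i<n. q i x) s sequentially"
    using assms(1) by (auto simp: uniformly_convergent_on_def)
  have sums: "(\<lambda>i. q i x) sums s x" for x
    using tendsto_uniform_limitI[OF s] by (simp add: sums_def)
  have s_eq: "s = (\<lambda>x. \<Sum>i. q i x)"
    using sums_unique[OF sums] by auto
  show "uniform_limit UNIV (\<lambda>n x. \<Sum>i<n. q i x) (\<lambda>x. \<Sum>i. q i x) sequentially"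
    using s s_eq by simp
  have "continuous_on UNIV s"
    by (rule uniform_limit_theorem[OF _ s])
      (use assms(2) in \<open>auto simp: CX_def intro!: always_eventually continuous_intros\<close>)
  then show "(\<lambda>x. \<Sum>i. q i x) \<in> CX"
    by (simp add: CX_def s_eq)
  show "summable (\<lambda>i. q i x)"
    using sums by (rule sums_summable)
qed

text \<open>The partial sums are continuous, so uniform convergence already makes the limit
  continuous, as \<open>l2CX\<close> demands.\<close>

lemma l2CX_iff_uniformly_convergent:
  "a \<in> l2CX \<longleftrightarrow> (\<forall>i. a i \<in> CX) \<and> uniformly_convergent_on UNIV (\<lambda>n x. \<Sum>i<n. cnj (a i x) * a i x)"
proof -
  have "uniformly_convergent_on UNIV (\<lambda>n x. \<Sum>i<n. cnj (a i x) * a i x) \<Longrightarrow> \<forall>i. a i \<in> CX \<Longrightarrow> a \<in> l2CX"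
    using CX_uniform_limit[of "\<lambda>i x. cnj (a i x) * a i x"] by (auto simp: l2CX_def CX_cnj CX_mult)
  then show ?thesis
    by (auto simp: l2CX_def uniformly_convergent_on_def)
qed

lemma cnj_mult_self: "cnj z * z = complex_of_real ((cmod z)\<^sup>2)"
  by (metis complex_norm_square mult.commute)

text \<open>The summands are nonnegative reals, so the modulus of a block is the block sum
  itself.\<close>

lemma l2CX_iff:
  "a \<in> l2CX \<longleftrightarrow> (\<forall>i. a i \<in> CX) \<and>
    (\<forall>e>0. \<exists>N. \<forall>m\<ge>N. \<forall>n\<ge>m. \<forall>x. (\<Sum>i=m..<n. (cmod (a i x))\<^sup>2) < e)"
proof -
  have "cmod (\<Sum>i=m..<n. cnj (a i x) * a i x) = (\<Sum>i=m..<n. (cmod (a i x))\<^sup>2)" for m n x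
    unfolding cnj_mult_self of_real_sum[symmetric] norm_of_real by (simp add: sum_nonneg)
  then show ?thesis
    unfolding l2CX_iff_uniformly_convergent uniformly_convergent_sum_iff by simp
qed

lemma l2CX_tail:
  assumes "a \<in> l2CX" "e > 0"
  obtains N where "\<And>m n x. m \<ge> N \<Longrightarrow> (\<Sum>i=m..<n. (cmod (a i x))\<^sup>2) < e"
proof -
  obtain N where "\<And>m n x. m \<ge> N \<Longrightarrow> n \<ge> m \<Longrightarrow> (\<Sum>i=m..<n. (cmod (a i x))\<^sup>2) < e"
    using assms unfolding l2CX_iff by blast
  \<comment> \<open>For \<open>n < m\<close> the sum is empty, and 0 is below
    \<open>e\<close>.\<close>
  then have "(\<Sum>i=m..<n. (cmod (a i x))\<^sup>2) < e" if "m \<ge> N" for m n x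
    using that assms(2) by (cases "n \<ge> m") auto
  then show ?thesis using that by blast
qed

text \<open>Each block of \<open>c\<close> is at most \<open>K\<close> times the sum of the blocks
  of \<open>a\<close> and \<open>b\<close>. This single criterion yields closure under truncation,
  addition and the action of C(X).\<close>

lemma l2CX_dominated:
  assumes a: "a \<in> l2CX" and b: "b \<in> l2CX" and c: "\<And>i. c i \<in> CX" and "K \<ge> 0"
    and le: "\<And>i x. (cmod (c i x))\<^sup>2 \<le> K * ((cmod (a i x))\<^sup>2 + (cmod (b i x))\<^sup>2)"
  shows "c \<in> l2CX"
  unfolding l2CX_iff
proof (intro conjI allI impI)
  fix e :: real
  assume e: "e > 0"
  \<comment> \<open>Dividing by \<open>K + 1\<close> covers \<open>K = 0\<close> and makes the final
    estimate strict.\<close>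
  define d where "d = e / (2 * (K + 1))"
  have d: "d > 0" using e \<open>K \<ge> 0\<close> by (simp add: d_def)
  obtain M where M: "\<And>m n x. m \<ge> M \<Longrightarrow> (\<Sum>i=m..<n. (cmod (a i x))\<^sup>2) < d"
    using l2CX_tail[OF a d] by blast
  obtain N where N: "\<And>m n x. m \<ge> N \<Longrightarrow> (\<Sum>i=m..<n. (cmod (b i x))\<^sup>2) < d"
    using l2CX_tail[OF b d] by blast
  show "\<exists>L. \<forall>m\<ge>L. \<forall>n\<ge>m. \<forall>x. (\<Sum>i=m..<n. (cmod (c i x))\<^sup>2) < e"
  proof (intro exI[of _ "max M N"] allI impI)
    fix m n x
    assume m: "max M N \<le> m"
    have "(\<Sum>i=m..<n. (cmod (c i x))\<^sup>2) \<le> (\<Sum>i=m..<n. K * ((cmod (a i x))\<^sup>2 + (cmod (b i x))\<^sup>2))"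
      by (intro sum_mono le)
    also have "\<dots> = K * ((\<Sum>i=m..<n. (cmod (a i x))\<^sup>2) + (\<Sum>i=m..<n. (cmod (b i x))\<^sup>2))"
      by (simp add: sum_distrib_left[symmetric] sum.distrib)
    also have "\<dots> \<le> K * (d + d)"
      using M[of m x n] N[of m x n] m \<open>K \<ge> 0\<close> by (intro mult_left_mono) auto
    also have "\<dots> < (K + 1) * (d + d)"
      using d by (simp add: algebra_simps)
    also have "\<dots> = e"
    proof -
      have "(K + 1) * (d + d) = 2 * (K + 1) * d" by (simp add: algebra_simps)
      then show ?thesis using \<open>K \<ge> 0\<close> by (simp add: d_def)
    qed
    finally show "(\<Sum>i=m..<n. (cmod (c i x))\<^sup>2) < e" .
  qed
qed (use c in auto)

lemma l2CX_summable:
  assumes "a \<in> l2CX"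
  shows "summable (\<lambda>i. (cmod (a i x))\<^sup>2)"
proof -
  have "uniformly_convergent_on UNIV (\<lambda>n x. \<Sum>i<n. cnj (a i x) * a i x)" "\<And>i. a i \<in> CX"
    using assms by (auto simp: l2CX_iff_uniformly_convergent)
  then have "summable (\<lambda>i. cnj (a i x) * a i x)"
    using CX_uniform_limit(3)[where q="\<lambda>i x. cnj (a i x) * a i x" and x=x] CX_cnj CX_mult by blast
  then show ?thesis
    unfolding cnj_mult_self summable_of_real_iff .
qed

lemma l2_inner_self:
  assumes "a \<in> l2CX"
  shows "l2_inner a a x = complex_of_real (\<Sum>i. (cmod (a i x))\<^sup>2)"
  unfolding l2_inner_def cnj_mult_self by (rule suminf_of_real[OF l2CX_summable[OF assms], symmetric])

lemma l2_inner_self_CX: "a \<in> l2CX \<Longrightarrow> l2_inner a a \<in> CX"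
  using CX_uniform_limit(1)[of "\<lambda>i x. cnj (a i x) * a i x"]
  unfolding l2_inner_def l2CX_iff_uniformly_convergent by (simp add: CX_cnj CX_mult)

lemma sqsum_le_mnorm:
  fixes a :: "nat \<Rightarrow> 'a::topological_space \<Rightarrow> complex"
  assumes "compact (UNIV :: 'a set)" "a \<in> l2CX"
  shows "(\<Sum>i<n. (cmod (a i x))\<^sup>2) \<le> (l2_mnorm a)\<^sup>2"
proof -
  have "(\<Sum>i<n. (cmod (a i x))\<^sup>2) \<le> (\<Sum>i. (cmod (a i x))\<^sup>2)"
    by (intro sum_le_suminf l2CX_summable assms) auto
  also have "\<dots> \<le> cmod (l2_inner a a x)"
    by (simp add: l2_inner_self assms)
  also have "\<dots> \<le> supnorm (l2_inner a a)"
    by (intro supnorm_upper l2_inner_self_CX assms)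
  finally have "(\<Sum>i<n. (cmod (a i x))\<^sup>2) \<le> supnorm (l2_inner a a)" .
  moreover have "0 \<le> (\<Sum>i<n. (cmod (a i x))\<^sup>2)"
    by (simp add: sum_nonneg)
  ultimately show ?thesis
    by (simp add: l2_mnorm_def)
qed

lemma l2_mnorm_nonneg:
  fixes a :: "nat \<Rightarrow> 'a::topological_space \<Rightarrow> complex"
  assumes "compact (UNIV :: 'a set)" "a \<in> l2CX"
  shows "0 \<le> l2_mnorm a"
  unfolding l2_mnorm_def
  using supnorm_upper[OF assms(1) l2_inner_self_CX[OF assms(2)]]
  by (meson norm_ge_zero order_trans real_sqrt_ge_zero)

lemma l2_mnorm_least:
  assumes "a \<in> l2CX" "0 \<le> b" "\<And>n x. (\<Sum>i<n. (cmod (a i x))\<^sup>2) \<le> b\<^sup>2"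
  shows "l2_mnorm a \<le> b"
proof -
  have "cmod (l2_inner a a x) \<le> b\<^sup>2" for x
    using suminf_le_const[OF l2CX_summable[OF assms(1)] assms(3)]
    by (simp add: l2_inner_self assms suminf_nonneg l2CX_summable)
  then have "supnorm (l2_inner a a) \<le> b\<^sup>2"
    by (rule supnorm_least)
  then show ?thesis
    unfolding l2_mnorm_def using assms(2) real_le_lsqrt by blast
qed

section \<open>Truncations, unit sequences and closure properties of \<open>l2CX\<close>\<close>

definition restr :: "nat set \<Rightarrow> (nat \<Rightarrow> 'a \<Rightarrow> complex) \<Rightarrow> nat \<Rightarrow> 'a \<Rightarrow> complex" where
  "restr I a = (\<lambda>i x. if i \<in> I then a i x else 0)"

text \<open>The standard basis vectors. Through \<open>pairing\<close> they also serve as the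
  coordinate functionals.\<close>

definition unit_seq :: "nat \<Rightarrow> nat \<Rightarrow> 'a \<Rightarrow> complex" where
  "unit_seq i = (\<lambda>j x. if j = i then 1 else 0)"

lemma CX_restr: "(\<And>i. a i \<in> CX) \<Longrightarrow> restr I a i \<in> CX"
  by (cases "i \<in> I") (auto simp: restr_def CX_const)

lemma l2CX_finite:
  assumes "finite I" "\<And>i. a i \<in> CX"
  shows "restr I a \<in> l2CX"
  unfolding l2CX_iff
proof (intro conjI allI impI)
  fix e :: real assume e: "e > 0"
  obtain N where N: "\<And>i. i \<in> I \<Longrightarrow> i < N"
    using assms(1) by (metis finite_nat_set_iff_bounded)
  show "\<exists>N. \<forall>m\<ge>N. \<forall>n\<ge>m. \<forall>x. (\<Sum>i=m..<n. (cmod (restr I a i x))\<^sup>2) < e"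
  proof (intro exI[of _ N] allI impI)
    fix m n x assume "N \<le> m"
    then have "(\<Sum>i=m..<n. (cmod (restr I a i x))\<^sup>2) = 0"
      using N by (intro sum.neutral) (force simp: restr_def)
    then show "(\<Sum>i=m..<n. (cmod (restr I a i x))\<^sup>2) < e" using e by simp
  qed
qed (simp add: CX_restr assms)

lemma unit_seq_eq_restr: "unit_seq i = restr {i} (\<lambda>j x. 1)"
  by (auto simp: unit_seq_def restr_def fun_eq_iff)

lemma unit_seq_l2CX: "unit_seq i \<in> l2CX"
  unfolding unit_seq_eq_restr by (rule l2CX_finite) (auto simp: CX_const)

lemma zero_l2CX: "(\<lambda>i x. 0) \<in> l2CX"
  using l2CX_finite[of "{}" "\<lambda>i x. 0"] by (simp add: restr_def CX_const)

lemma l2CX_CX: "a \<in> l2CX \<Longrightarrow> a i \<in> CX"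
  by (simp add: l2CX_def)

lemma l2CX_restr: "a \<in> l2CX \<Longrightarrow> restr I a \<in> l2CX"
  by (rule l2CX_dominated[where a=a and b=a and K=1]) (auto simp: CX_restr l2CX_CX, auto simp: restr_def)

lemma cmod_add_sq_le: "(cmod (z + w))\<^sup>2 \<le> 2 * ((cmod z)\<^sup>2 + (cmod w)\<^sup>2)"
proof -
  have "(cmod (z + w))\<^sup>2 \<le> (cmod z + cmod w)\<^sup>2"
    by (simp add: norm_triangle_ineq)
  also have "\<dots> \<le> 2 * ((cmod z)\<^sup>2 + (cmod w)\<^sup>2)"
    using sum_squares_bound[of "cmod z" "cmod w"] by (simp add: power2_sum)
  finally show ?thesis .
qed

lemma l2CX_add: "a \<in> l2CX \<Longrightarrow> b \<in> l2CX \<Longrightarrow> (\<lambda>i x. a i x + b i x) \<in> l2CX"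
  by (rule l2CX_dominated[where a=a and b=b and K=2]) (simp_all only: CX_add l2CX_CX cmod_add_sq_le zero_le_numeral)

lemma l2CX_act:
  fixes a :: "nat \<Rightarrow> 'a::topological_space \<Rightarrow> complex"
  assumes "compact (UNIV :: 'a set)" "a \<in> l2CX" "l \<in> CX"
  shows "l2_act a l \<in> l2CX"
proof (rule l2CX_dominated[where a=a and b=a and K="(supnorm l)\<^sup>2"])
  fix i x
  have "(cmod (l x))\<^sup>2 \<le> (supnorm l)\<^sup>2"
    by (intro power_mono supnorm_upper assms) auto
  then have "(cmod (l x))\<^sup>2 * (cmod (a i x))\<^sup>2 \<le> (supnorm l)\<^sup>2 * ((cmod (a i x))\<^sup>2 + (cmod (a i x))\<^sup>2)"
    by (intro mult_mono) auto
  then show "(cmod (l2_act a l i x))\<^sup>2 \<le> (supnorm l)\<^sup>2 * ((cmod (a i x))\<^sup>2 + (cmod (a i x))\<^sup>2)"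
    by (simp add: l2_act_def norm_mult power_mult_distrib mult.commute)
qed (use assms in \<open>auto simp: l2_act_def CX_mult l2CX_CX\<close>)


subsection \<open>The dual module\<close>

text \<open>The functional with coefficients \<open>t\<close>, which enter without conjugation.
  Outside \<open>l2CX\<close> it takes the default value 0 that \<open>l2_dual\<close>
  prescribes.\<close>

definition pairing :: "(nat \<Rightarrow> 'a::topological_space \<Rightarrow> complex) \<Rightarrow> (nat \<Rightarrow> 'a \<Rightarrow> complex) \<Rightarrow> 'a \<Rightarrow> complex" where
  "pairing t a = (if a \<in> l2CX then (\<lambda>x. \<Sum>i. t i x * a i x) else (\<lambda>x. 0))"

text \<open>The coefficient sequences of bounded functionals: the square sums are bounded but need
  not converge uniformly, which is the difference from \<open>l2CX\<close>. \<open>K\<close> bounds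
  the squared norm.\<close>

definition sqbdd :: "real \<Rightarrow> (nat \<Rightarrow> 'a::topological_space \<Rightarrow> complex) set" where
  "sqbdd K = {t. (\<forall>i. t i \<in> CX) \<and> (\<forall>n x. (\<Sum>i<n. (cmod (t i x))\<^sup>2) \<le> K)}"

lemma sqbdd_CX: "t \<in> sqbdd K \<Longrightarrow> t i \<in> CX"
  by (simp add: sqbdd_def)

lemma sqbdd_le: "t \<in> sqbdd K \<Longrightarrow> (\<Sum>i<n. (cmod (t i x))\<^sup>2) \<le> K"
  by (simp add: sqbdd_def)

lemma sqbdd_nonneg: "t \<in> sqbdd K \<Longrightarrow> 0 \<le> K"
  using sqbdd_le[of t K undefined 0] by simp

lemma sqbdd_I: "(\<And>i. t i \<in> CX) \<Longrightarrow> (\<And>n x. (\<Sum>i<n. (cmod (t i x))\<^sup>2) \<le> K) \<Longrightarrow> t \<in> sqbdd K"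
  by (simp add: sqbdd_def)

lemma sqbdd_restr: "t \<in> sqbdd K \<Longrightarrow> restr I t \<in> sqbdd K"
  by (rule sqbdd_I) (auto simp: CX_restr sqbdd_CX, auto simp: restr_def intro!: order_trans[OF sum_mono sqbdd_le[of t K]])

lemma sqbdd_add:
  assumes "t \<in> sqbdd K" "s \<in> sqbdd L"
  shows "(\<lambda>i x. t i x + s i x) \<in> sqbdd (2 * (K + L))"
proof (rule sqbdd_I)
  fix n x
  have "(\<Sum>i<n. (cmod (t i x + s i x))\<^sup>2) \<le> (\<Sum>i<n. 2 * ((cmod (t i x))\<^sup>2 + (cmod (s i x))\<^sup>2))"
    by (intro sum_mono cmod_add_sq_le)
  also have "\<dots> = 2 * ((\<Sum>i<n. (cmod (t i x))\<^sup>2) + (\<Sum>i<n. (cmod (s i x))\<^sup>2))"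
    by (simp add: sum_distrib_left[symmetric] sum.distrib)
  also have "\<dots> \<le> 2 * (K + L)"
    using sqbdd_le[OF assms(1), of x n] sqbdd_le[OF assms(2), of x n] by simp
  finally show "(\<Sum>i<n. (cmod (t i x + s i x))\<^sup>2) \<le> 2 * (K + L)" .
qed (use assms in \<open>auto simp: CX_add sqbdd_CX\<close>)

text \<open>The scalar is conjugated so as to match \<open>dual_act\<close>.\<close>

lemma sqbdd_act:
  fixes t :: "nat \<Rightarrow> 'a::topological_space \<Rightarrow> complex"
  assumes "compact (UNIV :: 'a set)" "t \<in> sqbdd K" "l \<in> CX"
  shows "(\<lambda>i x. cnj (l x) * t i x) \<in> sqbdd ((supnorm l)\<^sup>2 * K)"
proof (rule sqbdd_I)
  fix n x
  have "(\<Sum>i<n. (cmod (cnj (l x) * t i x))\<^sup>2) = (cmod (l x))\<^sup>2 * (\<Sum>i<n. (cmod (t i x))\<^sup>2)"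
    by (simp add: norm_mult power_mult_distrib sum_distrib_left)
  also have "\<dots> \<le> (supnorm l)\<^sup>2 * K"
    by (intro mult_mono power_mono supnorm_upper sqbdd_le assms) (auto intro: sum_nonneg)
  finally show "(\<Sum>i<n. (cmod (cnj (l x) * t i x))\<^sup>2) \<le> (supnorm l)\<^sup>2 * K" .
qed (use assms in \<open>auto intro!: CX_mult CX_cnj intro: sqbdd_CX[OF assms(2)]\<close>)

lemma sqsum_restr_le:
  assumes "finite I"
  shows "(\<Sum>i<n. (cmod (restr I t i x))\<^sup>2) \<le> (\<Sum>i\<in>I. (cmod (t i x))\<^sup>2)"
proof -
  have "(\<Sum>i<n. (cmod (restr I t i x))\<^sup>2) = (\<Sum>i\<in>{..<n} \<inter> I. (cmod (t i x))\<^sup>2)"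
    by (subst sum.inter_restrict) (auto simp: restr_def intro!: sum.cong)
  also have "\<dots> \<le> (\<Sum>i\<in>I. (cmod (t i x))\<^sup>2)"
    using assms by (intro sum_mono2) auto
  finally show ?thesis .
qed

lemma unit_seq_sqbdd: "unit_seq i \<in> sqbdd 1"
proof (rule sqbdd_I)
  fix n x
  show "(\<Sum>j<n. (cmod (unit_seq i j x))\<^sup>2) \<le> 1"
    unfolding unit_seq_eq_restr by (rule order_trans[OF sqsum_restr_le]) auto
qed (simp add: unit_seq_l2CX l2CX_CX)

lemma sqbdd_finite:
  fixes t :: "nat \<Rightarrow> 'a::topological_space \<Rightarrow> complex"
  assumes "compact (UNIV :: 'a set)" "finite I" "\<And>i. t i \<in> CX"
  shows "restr I t \<in> sqbdd (\<Sum>i\<in>I. (supnorm (t i))\<^sup>2)"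
proof (rule sqbdd_I)
  fix n x
  have "(\<Sum>i\<in>I. (cmod (t i x))\<^sup>2) \<le> (\<Sum>i\<in>I. (supnorm (t i))\<^sup>2)"
    by (intro sum_mono power_mono supnorm_upper assms) auto
  with sqsum_restr_le[OF assms(2)]
  show "(\<Sum>i<n. (cmod (restr I t i x))\<^sup>2) \<le> (\<Sum>i\<in>I. (supnorm (t i))\<^sup>2)"
    by (rule order_trans)
qed (simp add: CX_restr assms)

lemma cmod_sum_mult_sq_le:
  "(cmod (\<Sum>i\<in>I. t i * a i))\<^sup>2 \<le> (\<Sum>i\<in>I. (cmod (t i))\<^sup>2) * (\<Sum>i\<in>I. (cmod (a i))\<^sup>2)"
proof -
  have "cmod (\<Sum>i\<in>I. t i * a i) \<le> (\<Sum>i\<in>I. cmod (t i) * cmod (a i))"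
    by (rule order_trans[OF norm_sum]) (simp add: norm_mult)
  then have "(cmod (\<Sum>i\<in>I. t i * a i))\<^sup>2 \<le> (\<Sum>i\<in>I. cmod (t i) * cmod (a i))\<^sup>2"
    by (rule power_mono) auto
  also have "\<dots> \<le> (\<Sum>i\<in>I. (cmod (t i))\<^sup>2) * (\<Sum>i\<in>I. (cmod (a i))\<^sup>2)"
    by (rule Cauchy_Schwarz_ineq_sum)
  finally show ?thesis .
qed

text \<open>Cauchy-Schwarz on a block: the factor from \<open>t\<close> is at most \<open>K\<close>,
  the factor from \<open>a\<close> is small far out.\<close>

lemma pairing_uniformly_convergent:
  assumes t: "t \<in> sqbdd K" and a: "a \<in> l2CX"
  shows "uniformly_convergent_on UNIV (\<lambda>n x. \<Sum>i<n. t i x * a i x)"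
  unfolding uniformly_convergent_sum_iff
proof (intro allI impI)
  fix e :: real
  assume e: "e > 0"
  have K: "K \<ge> 0" using t by (rule sqbdd_nonneg)
  define d where "d = e\<^sup>2 / (K + 1)"
  have d: "d > 0" using e K by (simp add: d_def)
  obtain N where N: "\<And>m n x. m \<ge> N \<Longrightarrow> (\<Sum>i=m..<n. (cmod (a i x))\<^sup>2) < d"
    using l2CX_tail[OF a d] by blast
  show "\<exists>N. \<forall>m\<ge>N. \<forall>n\<ge>m. \<forall>x. cmod (\<Sum>i=m..<n. t i x * a i x) < e"
  proof (intro exI[of _ N] allI impI)
    fix m n x
    assume m: "N \<le> m"
    have "(\<Sum>i=m..<n. (cmod (t i x))\<^sup>2) \<le> (\<Sum>i<n. (cmod (t i x))\<^sup>2)"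
      by (intro sum_mono2) auto
    also have "\<dots> \<le> K" by (rule sqbdd_le[OF t])
    finally have "(\<Sum>i=m..<n. (cmod (t i x))\<^sup>2) \<le> K" .
    then have "(\<Sum>i=m..<n. (cmod (t i x))\<^sup>2) * (\<Sum>i=m..<n. (cmod (a i x))\<^sup>2) \<le> K * d"
      using N[OF m, where x=x and n=n] K by (intro mult_mono) (auto intro: sum_nonneg)
    with cmod_sum_mult_sq_le have "(cmod (\<Sum>i=m..<n. t i x * a i x))\<^sup>2 \<le> K * d"
      by (rule order_trans)
    also have "\<dots> < (K + 1) * d" using d by (simp add: algebra_simps)
    also have "\<dots> = e\<^sup>2" using K by (simp add: d_def)
    finally show "cmod (\<Sum>i=m..<n. t i x * a i x) < e"
      using e power_less_imp_less_base less_imp_le by blast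
  qed
qed

lemma pairing_tendsto:
  assumes "t \<in> sqbdd K" "a \<in> l2CX"
  shows "(\<lambda>i. t i x * a i x) sums pairing t a x"
proof -
  have "summable (\<lambda>i. t i x * a i x)"
    by (rule CX_uniform_limit(3)[OF pairing_uniformly_convergent[OF assms]])
      (use assms in \<open>auto intro: CX_mult sqbdd_CX l2CX_CX\<close>)
  then show ?thesis
    using assms(2) by (simp add: pairing_def summable_sums)
qed

lemma pairing_CX: "t \<in> sqbdd K \<Longrightarrow> pairing t a \<in> CX"
  using CX_uniform_limit(1)[OF pairing_uniformly_convergent, of t K a]
  by (cases "a \<in> l2CX") (auto simp: pairing_def CX_const CX_mult sqbdd_CX l2CX_CX)

text \<open>Cauchy-Schwarz for partial sums, then the limit. The bound \<open>b\<close> concerns the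
  point \<open>x\<close> alone, so it may be far smaller than \<open>K\<close>; this is used where a
  tail of \<open>t\<close> is small only locally.\<close>

lemma cmod_pairing_le:
  fixes a :: "nat \<Rightarrow> 'a::topological_space \<Rightarrow> complex"
  assumes "compact (UNIV :: 'a set)" "t \<in> sqbdd K" "a \<in> l2CX"
    and b: "\<And>n. (\<Sum>i<n. (cmod (t i x))\<^sup>2) \<le> b"
  shows "cmod (pairing t a x) \<le> sqrt b * l2_mnorm a"
proof -
  have b0: "0 \<le> b" using b[of 0] by simp
  have "cmod (\<Sum>i<n. t i x * a i x) \<le> sqrt b * l2_mnorm a" for n
  proof -
    have "(\<Sum>i<n. (cmod (t i x))\<^sup>2) * (\<Sum>i<n. (cmod (a i x))\<^sup>2) \<le> b * (l2_mnorm a)\<^sup>2"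
      using assms b0 by (intro mult_mono b sqsum_le_mnorm) (auto intro: sum_nonneg)
    with cmod_sum_mult_sq_le have "(cmod (\<Sum>i<n. t i x * a i x))\<^sup>2 \<le> b * (l2_mnorm a)\<^sup>2"
      by (rule order_trans)
    also have "\<dots> = (sqrt b * l2_mnorm a)\<^sup>2"
      using b0 by (simp add: power_mult_distrib)
    finally show ?thesis
      by (rule power2_le_imp_le) (use assms b0 in \<open>simp add: l2_mnorm_nonneg\<close>)
  qed
  moreover have "(\<lambda>n. cmod (\<Sum>i<n. t i x * a i x)) \<longlonglongrightarrow> cmod (pairing t a x)"
    using pairing_tendsto[OF assms(2,3)] unfolding sums_def by (rule tendsto_norm)
  ultimately show ?thesis
    by (intro LIMSEQ_le_const2) auto
qed

lemma supnorm_pairing_le: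
  fixes a :: "nat \<Rightarrow> 'a::topological_space \<Rightarrow> complex"
  assumes "compact (UNIV :: 'a set)" "t \<in> sqbdd K" "a \<in> l2CX"
  shows "supnorm (pairing t a) \<le> sqrt K * l2_mnorm a"
  by (intro supnorm_least cmod_pairing_le[OF assms] sqbdd_le[OF assms(2)])

lemma pairing_add:
  assumes "t \<in> sqbdd K" "s \<in> sqbdd L"
  shows "pairing (\<lambda>i x. t i x + s i x) = (\<lambda>a x. pairing t a x + pairing s a x)"
proof (intro ext)
  fix a x
  show "pairing (\<lambda>i x. t i x + s i x) a x = pairing t a x + pairing s a x"
  proof (cases "a \<in> l2CX")
    case True
    have "(\<lambda>i. t i x * a i x + s i x * a i x) sums (pairing t a x + pairing s a x)"
      by (intro sums_add pairing_tendsto[OF assms(1)] pairing_tendsto[OF assms(2)] True)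
    then show ?thesis
      using pairing_tendsto[OF sqbdd_add[OF assms] True, of x] by (auto simp: algebra_simps dest: sums_unique2)
  qed (simp add: pairing_def)
qed

lemma pairing_act:
  fixes t :: "nat \<Rightarrow> 'a::topological_space \<Rightarrow> complex"
  assumes "compact (UNIV :: 'a set)" "t \<in> sqbdd K" "l \<in> CX"
  shows "pairing (\<lambda>i x. cnj (l x) * t i x) = dual_act (pairing t) l"
proof (intro ext)
  fix a x
  show "pairing (\<lambda>i x. cnj (l x) * t i x) a x = dual_act (pairing t) l a x"
  proof (cases "a \<in> l2CX")
    case True
    have "(\<lambda>i. cnj (l x) * (t i x * a i x)) sums (cnj (l x) * pairing t a x)"
      by (intro sums_mult pairing_tendsto[OF assms(2) True])
    then show ?thesis
      using pairing_tendsto[OF sqbdd_act[OF assms] True, of x]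
      by (auto simp: dual_act_def mult.assoc dest: sums_unique2)
  qed (simp add: pairing_def dual_act_def)
qed

lemma pairing_in_dual:
  fixes t :: "nat \<Rightarrow> 'a::topological_space \<Rightarrow> complex"
  assumes c: "compact (UNIV :: 'a set)" and t: "t \<in> sqbdd K"
  shows "pairing t \<in> l2_dual"
  unfolding l2_dual_def
proof (intro CollectI conjI ballI allI impI)
  fix a b :: "nat \<Rightarrow> 'a \<Rightarrow> complex"
  assume ab: "a \<in> l2CX" "b \<in> l2CX"
  show "pairing t (\<lambda>i x. a i x + b i x) = (\<lambda>x. pairing t a x + pairing t b x)"
  proof
    fix x
    have "(\<lambda>i. t i x * a i x + t i x * b i x) sums (pairing t a x + pairing t b x)"
      by (intro sums_add pairing_tendsto[OF t] ab)
    then show "pairing t (\<lambda>i x. a i x + b i x) x = pairing t a x + pairing t b x"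
      using pairing_tendsto[OF t l2CX_add[OF ab], of x] by (auto simp: algebra_simps dest: sums_unique2)
  qed
next
  fix a :: "nat \<Rightarrow> 'a \<Rightarrow> complex" and l :: "'a \<Rightarrow> complex"
  assume al: "a \<in> l2CX" "l \<in> CX"
  show "pairing t (l2_act a l) = (\<lambda>x. pairing t a x * l x)"
  proof
    fix x
    have "(\<lambda>i. (t i x * a i x) * l x) sums (pairing t a x * l x)"
      by (intro sums_mult2 pairing_tendsto[OF t] al)
    then show "pairing t (l2_act a l) x = pairing t a x * l x"
      using pairing_tendsto[OF t l2CX_act[OF c al], of x]
      by (auto simp: l2_act_def mult.assoc dest: sums_unique2)
  qed
next
  show "\<exists>C. \<forall>a\<in>l2CX. supnorm (pairing t a) \<le> C * l2_mnorm a"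
    using supnorm_pairing_le[OF c t] by blast
qed (use pairing_CX[OF t] in blast, simp add: pairing_def)

section \<open>Every bounded functional is given by a coefficient sequence\<close>

lemma l2_dual_CX: "T \<in> l2_dual \<Longrightarrow> T a \<in> CX"
  by (cases "a \<in> l2CX") (auto simp: l2_dual_def CX_const)

lemma l2_dual_add: "T \<in> l2_dual \<Longrightarrow> a \<in> l2CX \<Longrightarrow> b \<in> l2CX \<Longrightarrow> T (\<lambda>i x. a i x + b i x) = (\<lambda>x. T a x + T b x)"
  by (simp add: l2_dual_def)

lemma l2_dual_act: "T \<in> l2_dual \<Longrightarrow> a \<in> l2CX \<Longrightarrow> l \<in> CX \<Longrightarrow> T (l2_act a l) = (\<lambda>x. T a x * l x)"
  by (simp add: l2_dual_def)

text \<open>A finitely supported sequence is a finite sum of unit vectors acted on by its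
  coordinates.\<close>

lemma l2_dual_finite:
  fixes T :: "(nat \<Rightarrow> 'a::topological_space \<Rightarrow> complex) \<Rightarrow> 'a \<Rightarrow> complex"
  assumes c: "compact (UNIV :: 'a set)" and T: "T \<in> l2_dual" and "finite I" and a: "\<And>i. a i \<in> CX"
  shows "T (restr I a) = (\<lambda>x. \<Sum>i\<in>I. T (unit_seq i) x * a i x)"
  using \<open>finite I\<close>
proof (induction I)
  case empty
  \<comment> \<open>The zero sequence equals itself times the scalar 0, so module linearity makes
    \<open>T\<close> vanish there.\<close>
  have "T (restr {} a) = T (l2_act (restr {} a) (\<lambda>x. 0))"
    by (simp add: restr_def l2_act_def)
  also have "\<dots> = (\<lambda>x. 0)"
    using l2_dual_act[OF T l2CX_finite[of "{}", OF _ a] CX_const[of 0]] by simp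
  finally show ?case by simp
next
  case (insert j I)
  have "restr (insert j I) a = (\<lambda>i x. restr I a i x + l2_act (unit_seq j) (a j) i x)"
    using insert.hyps(2) by (auto simp: restr_def l2_act_def unit_seq_def fun_eq_iff)
  then have "T (restr (insert j I) a) = (\<lambda>x. T (restr I a) x + T (unit_seq j) x * a j x)"
    using T insert.hyps(1) a c by (simp add: l2_dual_add l2_dual_act l2CX_finite l2CX_act unit_seq_l2CX)
  then show ?case
    using insert by (simp add: add.commute)
qed

lemma l2_dual_bound:
  fixes T :: "(nat \<Rightarrow> 'a::topological_space \<Rightarrow> complex) \<Rightarrow> 'a \<Rightarrow> complex"
  assumes c: "compact (UNIV :: 'a set)" and T: "T \<in> l2_dual"
  obtains C where "C \<ge> 0" "\<And>a. a \<in> l2CX \<Longrightarrow> supnorm (T a) \<le> C * l2_mnorm a"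
proof -
  obtain C where C: "\<And>a. a \<in> l2CX \<Longrightarrow> supnorm (T a) \<le> C * l2_mnorm a"
    using T unfolding l2_dual_def by blast
  have "supnorm (T a) \<le> \<bar>C\<bar> * l2_mnorm a" if "a \<in> l2CX" for a
    using C[OF that] l2_mnorm_nonneg[OF c that]
    by (meson abs_ge_self mult_right_mono order_trans)
  then show ?thesis
    using that[of "\<bar>C\<bar>"] by simp
qed

text \<open>The coefficients are the values on unit vectors. Their square sums are bounded by
  self-testing, and then \<open>T\<close> agrees with the pairing on truncations, while boundedness
  of \<open>T\<close> controls the tails.\<close>

lemma l2_dual_eq_pairing:
  fixes T :: "(nat \<Rightarrow> 'a::topological_space \<Rightarrow> complex) \<Rightarrow> 'a \<Rightarrow> complex"
  assumes c: "compact (UNIV :: 'a set)" and T: "T \<in> l2_dual"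
  obtains t K where "t \<in> sqbdd K" "T = pairing t"
proof -
  obtain C where C: "C \<ge> 0" "\<And>a. a \<in> l2CX \<Longrightarrow> supnorm (T a) \<le> C * l2_mnorm a"
    using l2_dual_bound[OF c T] by blast
  define t where "t i = T (unit_seq i)" for i
  have tCX: "t i \<in> CX" for i
    by (simp add: t_def l2_dual_CX T)
  have t: "t \<in> sqbdd (C\<^sup>2)"
  proof (rule sqbdd_I[OF tCX])
    fix n x
    \<comment> \<open>On this truncation of the conjugate coefficients \<open>T\<close> takes the
      value \<open>S\<close>, while the norm of \<open>a\<close> is at most the root of the supremum
      of \<open>S\<close>.\<close>
    define a where "a = restr {..<n} (\<lambda>i x. cnj (t i x))"
    define S where "S x = (\<Sum>i<n. (cmod (t i x))\<^sup>2)" for x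
    have S0: "S x \<ge> 0" for x by (simp add: S_def sum_nonneg)
    have a: "a \<in> l2CX" unfolding a_def by (rule l2CX_finite) (auto simp: CX_cnj tCX)
    have Ta: "T a = (\<lambda>x. complex_of_real (S x))"
      unfolding a_def by (subst l2_dual_finite[OF c T])
        (auto simp: CX_cnj tCX t_def[symmetric] S_def mult.commute[of "t _ _"] cnj_mult_self fun_eq_iff
          simp del: of_real_power)
    have SM: "S x \<le> supnorm (T a)" for x
      using supnorm_upper[OF c l2_dual_CX[OF T, of a], of x] S0[of x] by (simp add: Ta)
    have "(\<Sum>i<m. (cmod (a i x))\<^sup>2) \<le> (sqrt (supnorm (T a)))\<^sup>2" for m x
    proof -
      have "(\<Sum>i<m. (cmod (a i x))\<^sup>2) \<le> S x"
        unfolding a_def S_def by (rule order_trans[OF sqsum_restr_le]) auto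
      then show ?thesis using SM[of x] S0[of x] by simp
    qed
    then have "l2_mnorm a \<le> sqrt (supnorm (T a))"
      using SM[of x] S0[of x] by (intro l2_mnorm_least[OF a]) auto
    then have "supnorm (T a) \<le> C * sqrt (supnorm (T a))"
      by (intro order_trans[OF C(2)[OF a]] mult_left_mono C(1))
    moreover have "supnorm (T a) = sqrt (supnorm (T a)) * sqrt (supnorm (T a))"
      using SM[of x] S0[of x] by simp
    \<comment> \<open>A positive root cancels; a zero root is covered by
      \<open>C \<ge> 0\<close>.\<close>
    ultimately have "sqrt (supnorm (T a)) \<le> C"
      using C(1) SM[of x] S0[of x]
      by (metis mult_le_cancel_right not_le order_trans real_sqrt_ge_zero)
    then have "(sqrt (supnorm (T a)))\<^sup>2 \<le> C\<^sup>2"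
      using SM[of x] S0[of x] by (intro power_mono) auto
    then show "(\<Sum>i<n. (cmod (t i x))\<^sup>2) \<le> C\<^sup>2"
      using SM[of x] S0[of x] by (simp add: S_def)
  qed
  have "T a x = pairing t a x" for a x
  proof (cases "a \<in> l2CX")
    case a: True
    have "(\<lambda>n. \<Sum>i<n. t i x * a i x) \<longlonglongrightarrow> T a x"
    proof (rule LIMSEQ_I)
      fix e :: real
      assume e: "e > 0"
      define d where "d = e / (C + 1)"
      have d: "d > 0" using e C(1) by (simp add: d_def)
      obtain N where N: "\<And>m n x. m \<ge> N \<Longrightarrow> (\<Sum>i=m..<n. (cmod (a i x))\<^sup>2) < d\<^sup>2"
        using l2CX_tail[OF a, of "d\<^sup>2"] d by auto
      have "norm ((\<Sum>i<n. t i x * a i x) - T a x) < e" if n: "n \<ge> N" for n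
      proof -
        have "a = (\<lambda>i x. restr {..<n} a i x + restr {n..} a i x)"
          by (auto simp: restr_def fun_eq_iff)
        then have "T a x = T (restr {..<n} a) x + T (restr {n..} a) x"
          using l2_dual_add[OF T l2CX_restr[OF a] l2CX_restr[OF a], of "{..<n}" "{n..}"] by metis
        also have "T (restr {..<n} a) x = (\<Sum>i<n. t i x * a i x)"
          by (subst l2_dual_finite[OF c T]) (auto simp: l2CX_CX a t_def)
        finally have "norm ((\<Sum>i<n. t i x * a i x) - T a x) = cmod (T (restr {n..} a) x)"
          by simp
        also have "\<dots> \<le> supnorm (T (restr {n..} a))"
          by (intro supnorm_upper c l2_dual_CX T)
        also have "\<dots> \<le> C * l2_mnorm (restr {n..} a)"
          by (intro C l2CX_restr a)
        also have "\<dots> \<le> C * d"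
        proof (intro mult_left_mono l2_mnorm_least l2CX_restr a C(1))
          fix m x
          have "(\<Sum>i<m. (cmod (restr {n..} a i x))\<^sup>2) = (\<Sum>i=n..<m. (cmod (a i x))\<^sup>2)"
            by (rule sum.mono_neutral_cong_right) (auto simp: restr_def)
          then show "(\<Sum>i<m. (cmod (restr {n..} a i x))\<^sup>2) \<le> d\<^sup>2"
            using N[OF n, of x m] by simp
        qed (use d in simp)
        also have "\<dots> < (C + 1) * d" using d by (simp add: algebra_simps)
        also have "\<dots> = e" using C(1) by (simp add: d_def)
        finally show ?thesis .
      qed
      then show "\<exists>no. \<forall>n\<ge>no. norm ((\<Sum>i<n. t i x * a i x) - T a x) < e" by blast
    qed
    then show ?thesis
      using pairing_tendsto[OF t a, of x] LIMSEQ_unique unfolding sums_def by blast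
  next
    case False
    then show ?thesis using T by (simp add: l2_dual_def pairing_def)
  qed
  then show ?thesis
    using that[OF t] by blast
qed

section \<open>The norm of the dual module and its closure under the operations\<close>

lemma supnorm_le_dual_norm:
  fixes T :: "(nat \<Rightarrow> 'a::topological_space \<Rightarrow> complex) \<Rightarrow> 'a \<Rightarrow> complex"
  assumes c: "compact (UNIV :: 'a set)" and T: "T \<in> l2_dual" and a: "a \<in> l2CX" "l2_mnorm a \<le> 1"
  shows "supnorm (T a) \<le> dual_norm T"
proof -
  obtain C where C: "C \<ge> 0" "\<And>a. a \<in> l2CX \<Longrightarrow> supnorm (T a) \<le> C * l2_mnorm a"
    using l2_dual_bound[OF c T] by blast
  have "supnorm (T b) \<le> C" if "b \<in> l2CX" "l2_mnorm b \<le> 1" for b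
    using C(2)[OF that(1)] mult_left_mono[OF that(2) C(1)] by simp
  then have "bdd_above ((\<lambda>a. supnorm (T a)) ` {a \<in> l2CX. l2_mnorm a \<le> 1})"
    by (intro bdd_aboveI2[where M=C]) auto
  then show ?thesis
    unfolding dual_norm_def using a by (intro cSUP_upper) auto
qed

lemma l2_mnorm_zero: "l2_mnorm (\<lambda>i (x :: 'a::topological_space). 0) \<le> 0"
  by (rule l2_mnorm_least[OF zero_l2CX]) auto

lemma l2_mnorm_unit_seq: "l2_mnorm (unit_seq i :: nat \<Rightarrow> 'a::topological_space \<Rightarrow> complex) \<le> 1"
  by (rule l2_mnorm_least[OF unit_seq_l2CX]) (auto intro: sqbdd_le unit_seq_sqbdd)

lemma dual_norm_nonneg:
  fixes T :: "(nat \<Rightarrow> 'a::topological_space \<Rightarrow> complex) \<Rightarrow> 'a \<Rightarrow> complex"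
  assumes c: "compact (UNIV :: 'a set)" and T: "T \<in> l2_dual"
  shows "0 \<le> dual_norm T"
proof -
  have "0 \<le> supnorm (T (\<lambda>i x. 0))"
    by (rule order_trans[OF norm_ge_zero supnorm_upper[OF c l2_dual_CX[OF T]]])
  also have "\<dots> \<le> dual_norm T"
    using l2_mnorm_zero by (intro supnorm_le_dual_norm[OF c T] zero_l2CX) (rule order_trans, auto)
  finally show ?thesis .
qed

lemma dual_norm_pairing_le:
  fixes t :: "nat \<Rightarrow> 'a::topological_space \<Rightarrow> complex"
  assumes c: "compact (UNIV :: 'a set)" and t: "t \<in> sqbdd K"
  shows "dual_norm (pairing t) \<le> sqrt K"
  unfolding dual_norm_def
proof (rule cSUP_least)
  show "{a \<in> l2CX. l2_mnorm a \<le> 1} \<noteq> ({} :: (nat \<Rightarrow> 'a \<Rightarrow> complex) set)"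
    using zero_l2CX l2_mnorm_zero by (metis (mono_tags, lifting) empty_iff mem_Collect_eq order_trans zero_le_one)
  fix a :: "nat \<Rightarrow> 'a \<Rightarrow> complex"
  assume a: "a \<in> {a \<in> l2CX. l2_mnorm a \<le> 1}"
  then have "supnorm (pairing t a) \<le> sqrt K * l2_mnorm a"
    by (intro supnorm_pairing_le c t) auto
  also have "\<dots> \<le> sqrt K * 1"
    using a sqbdd_nonneg[OF t] by (intro mult_left_mono) auto
  finally show "supnorm (pairing t a) \<le> sqrt K" by simp
qed


lemma pairing_unit_seq: "a \<in> l2CX \<Longrightarrow> pairing (unit_seq k) a = a k"
proof
  fix x
  assume a: "a \<in> l2CX"
  have "(\<lambda>i. unit_seq k i x * a i x) = (\<lambda>i. if i = k then a i x else 0)"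
    by (auto simp: unit_seq_def)
  then have "(\<lambda>i. unit_seq k i x * a i x) sums a k x"
    using sums_single[of k "\<lambda>i. a i x"] by simp
  then show "pairing (unit_seq k) a x = a k x"
    using pairing_tendsto[OF unit_seq_sqbdd a] sums_unique2 by blast
qed

text \<open>Coefficient sequences turn this into the closure of square-bounded sequences under
  addition.\<close>

lemma l2_dual_closed_add:
  fixes T :: "(nat \<Rightarrow> 'a::topological_space \<Rightarrow> complex) \<Rightarrow> 'a \<Rightarrow> complex"
  assumes c: "compact (UNIV :: 'a set)" and "T \<in> l2_dual" "S \<in> l2_dual"
  shows "(\<lambda>a x. T a x + S a x) \<in> l2_dual"
proof -
  obtain t K where t: "t \<in> sqbdd K" "T = pairing t"
    using l2_dual_eq_pairing[OF c assms(2)] by blast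
  obtain s L where s: "s \<in> sqbdd L" "S = pairing s"
    using l2_dual_eq_pairing[OF c assms(3)] by blast
  show ?thesis
    using pairing_in_dual[OF c sqbdd_add[OF t(1) s(1)]] by (simp add: pairing_add[OF t(1) s(1)] t s)
qed

lemma l2_dual_closed_act:
  fixes T :: "(nat \<Rightarrow> 'a::topological_space \<Rightarrow> complex) \<Rightarrow> 'a \<Rightarrow> complex"
  assumes c: "compact (UNIV :: 'a set)" and "T \<in> l2_dual" and l: "l \<in> CX"
  shows "dual_act T l \<in> l2_dual"
proof -
  obtain t K where t: "t \<in> sqbdd K" "T = pairing t"
    using l2_dual_eq_pairing[OF c assms(2)] by blast
  show ?thesis
    using pairing_in_dual[OF c sqbdd_act[OF c t(1) l]] by (simp add: pairing_act[OF c t(1) l] t)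
qed

subsection \<open>The bidual module\<close>

lemma l2_hat_in_bidual:
  fixes a :: "nat \<Rightarrow> 'a::topological_space \<Rightarrow> complex"
  assumes c: "compact (UNIV :: 'a set)" and a: "a \<in> l2CX"
  shows "l2_hat a \<in> l2_bidual"
  unfolding l2_bidual_def
proof (intro CollectI conjI ballI allI impI)
  \<comment> \<open>Adding 1 keeps \<open>r\<close> positive even for \<open>a = 0\<close>, so that
    \<open>a\<close> divided by \<open>r\<close> lies in the unit ball over which
    \<open>dual_norm\<close> is a supremum.\<close>
  define r where "r = l2_mnorm a + 1"
  have r: "r > 0" "l2_mnorm a \<le> r" using l2_mnorm_nonneg[OF c a] by (auto simp: r_def)
  have rc: "(\<lambda>x. complex_of_real (1 / r)) \<in> CX" by (rule CX_const)
  have "supnorm (l2_hat a T) \<le> r * dual_norm T" if T: "T \<in> l2_dual" for T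
  proof (rule supnorm_least)
    fix x
    define b where "b = l2_act a (\<lambda>x. complex_of_real (1 / r))"
    have b: "b \<in> l2CX" unfolding b_def by (intro l2CX_act c a rc)
    have "l2_mnorm b \<le> 1"
    proof (rule l2_mnorm_least[OF b])
      fix n x
      have "(\<Sum>i<n. (cmod (b i x))\<^sup>2) = (\<Sum>i<n. (cmod (a i x))\<^sup>2) / r\<^sup>2"
        using r by (simp add: b_def l2_act_def norm_divide power_divide sum_divide_distrib)
      also have "\<dots> \<le> (l2_mnorm a)\<^sup>2 / r\<^sup>2"
        by (intro divide_right_mono sqsum_le_mnorm c a) auto
      also have "\<dots> \<le> r\<^sup>2 / r\<^sup>2"
        using r l2_mnorm_nonneg[OF c a] by (intro divide_right_mono power_mono) auto
      finally show "(\<Sum>i<n. (cmod (b i x))\<^sup>2) \<le> 1\<^sup>2" using r by simp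
    qed simp
    then have "cmod (T b x) \<le> dual_norm T"
      using supnorm_upper[OF c l2_dual_CX[OF T]] supnorm_le_dual_norm[OF c T b] order_trans by blast
    moreover have "T b x = T a x / r"
      unfolding b_def l2_dual_act[OF T a rc] by simp
    ultimately show "cmod (l2_hat a T x) \<le> r * dual_norm T"
      using r T by (simp add: l2_hat_def norm_divide field_simps)
  qed
  then show "\<exists>C. \<forall>T\<in>l2_dual. supnorm (l2_hat a T) \<le> C * dual_norm T" by blast
qed (use l2_dual_closed_add[OF c] l2_dual_closed_act[OF c]
    in \<open>auto simp: l2_hat_def CX_cnj[OF l2_dual_CX] dual_act_def mult.commute\<close>)

section \<open>A fixed element of the bidual and its coefficients\<close>

locale l2_bidual_elem =
  fixes \<Phi> :: "((nat \<Rightarrow> 'a::t2_space \<Rightarrow> complex) \<Rightarrow> 'a \<Rightarrow> complex) \<Rightarrow> 'a \<Rightarrow> complex" and C :: real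
  assumes cpt: "compact (UNIV :: 'a set)" and Phi: "\<Phi> \<in> l2_bidual" and C: "C \<ge> 0"
    and bound: "T \<in> l2_dual \<Longrightarrow> supnorm (\<Phi> T) \<le> C * dual_norm T"
begin

text \<open>\<Phi> transported to coefficient sequences. It is conjugate-linear in \<open>t\<close>,
  because \<open>dual_act\<close> conjugates its scalar.\<close>

definition phi :: "(nat \<Rightarrow> 'a \<Rightarrow> complex) \<Rightarrow> 'a \<Rightarrow> complex" where
  "phi t = \<Phi> (pairing t)"

text \<open>If \<Phi> is evaluation at \<open>a\<close>, then \<open>gen i\<close> is the conjugate
  of \<open>a i\<close>.\<close>

definition gen :: "nat \<Rightarrow> 'a \<Rightarrow> complex" where
  "gen i = phi (unit_seq i)"

lemma phi_CX: "t \<in> sqbdd K \<Longrightarrow> phi t \<in> CX"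
  using Phi pairing_in_dual[OF cpt] by (auto simp: phi_def l2_bidual_def)

lemma phi_add:
  assumes "t \<in> sqbdd K" "s \<in> sqbdd L"
  shows "phi (\<lambda>i x. t i x + s i x) = (\<lambda>x. phi t x + phi s x)"
  using Phi pairing_in_dual[OF cpt assms(1)] pairing_in_dual[OF cpt assms(2)]
  by (simp add: phi_def l2_bidual_def pairing_add[OF assms])

lemma phi_act:
  assumes "t \<in> sqbdd K" "l \<in> CX"
  shows "phi (\<lambda>i x. cnj (l x) * t i x) = (\<lambda>x. phi t x * l x)"
  using Phi pairing_in_dual[OF cpt assms(1)] assms(2)
  by (simp add: phi_def l2_bidual_def pairing_act[OF cpt assms])

lemma phi_bound:
  assumes t: "t \<in> sqbdd K"
  shows "cmod (phi t x) \<le> C * sqrt K"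
proof -
  have "cmod (phi t x) \<le> supnorm (phi t)"
    by (intro supnorm_upper cpt phi_CX[OF t])
  also have "\<dots> \<le> C * dual_norm (pairing t)"
    unfolding phi_def by (intro bound pairing_in_dual[OF cpt t])
  also have "\<dots> \<le> C * sqrt K"
    by (intro mult_left_mono dual_norm_pairing_le[OF cpt t] C)
  finally show ?thesis .
qed

text \<open>Multiplying by a bump function localises the norm estimate.\<close>
lemma phi_local:
  assumes t: "t \<in> sqbdd K" and W: "open W" "x \<in> W"
    and b: "\<And>y n. y \<in> W \<Longrightarrow> (\<Sum>i<n. (cmod (t i y))\<^sup>2) \<le> b"
  shows "cmod (phi t x) \<le> C * sqrt b"
proof -
  obtain l :: "'a \<Rightarrow> real" where l: "continuous_on UNIV l" "\<And>y. 0 \<le> l y" "\<And>y. l y \<le> 1"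
    "l x = 1" "\<And>y. y \<notin> W \<Longrightarrow> l y = 0"
    using urysohn_bump[OF cpt W] by blast
  define m where "m y = complex_of_real (l y)" for y
  have m: "m \<in> CX" unfolding m_def by (rule CX_of_real[OF l(1)])
  have b0: "0 \<le> b" using b[OF W(2), of 0] by simp
  have "(\<lambda>i x. cnj (m x) * t i x) \<in> sqbdd b"
  proof (rule sqbdd_I)
    fix n y
    have eq: "(\<Sum>i<n. (cmod (cnj (m y) * t i y))\<^sup>2) = (l y)\<^sup>2 * (\<Sum>i<n. (cmod (t i y))\<^sup>2)"
      by (simp add: m_def norm_mult power_mult_distrib sum_distrib_left)
    show "(\<Sum>i<n. (cmod (cnj (m y) * t i y))\<^sup>2) \<le> b"
    proof (cases "y \<in> W")
      case True
      have "(l y)\<^sup>2 * (\<Sum>i<n. (cmod (t i y))\<^sup>2) \<le> 1 * b"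
        using l(2,3) b[OF True] by (intro mult_mono power_le_one) (auto intro: sum_nonneg)
      then show ?thesis using eq by simp
    next
      case False
      then show ?thesis using eq b0 l(5) by simp
    qed
  qed (use m t in \<open>auto intro!: CX_mult CX_cnj intro: sqbdd_CX\<close>)
  then have "cmod (phi (\<lambda>i x. cnj (m x) * t i x) x) \<le> C * sqrt b"
    by (rule phi_bound)
  then show ?thesis
    using phi_act[OF t m] l(4) by (simp add: m_def)
qed

lemma phi_local_zero:
  assumes "t \<in> sqbdd K" "open W" "x \<in> W" "\<And>y i. y \<in> W \<Longrightarrow> t i y = 0"
  shows "phi t x = 0"
  using phi_local[OF assms(1-3), of 0] assms(4) by simp

lemma gen_CX: "gen i \<in> CX"
  unfolding gen_def by (rule phi_CX[OF unit_seq_sqbdd])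

lemma phi_finite:
  assumes "finite I" and t: "\<And>i. t i \<in> CX"
  shows "phi (restr I t) = (\<lambda>x. \<Sum>i\<in>I. cnj (t i x) * gen i x)"
  using \<open>finite I\<close>
proof (induction I)
  case empty
  have "restr {} t \<in> sqbdd 0"
    by (rule sqbdd_I) (auto simp: restr_def CX_const)
  then have "phi (restr {} t) x = 0" for x
    using phi_bound[of "restr {} t" 0] by simp
  then show ?case by auto
next
  case (insert j I)
  \<comment> \<open>The double conjugate presents the new term as the action of the scalar
    \<open>cnj (t j)\<close> on a unit sequence.\<close>
  have "restr (insert j I) t = (\<lambda>i x. restr I t i x + cnj (cnj (t j x)) * unit_seq j i x)"
    using insert.hyps(2) by (auto simp: restr_def unit_seq_def fun_eq_iff)
  then have "phi (restr (insert j I) t)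
    = (\<lambda>x. phi (restr I t) x + phi (\<lambda>i x. cnj (cnj (t j x)) * unit_seq j i x) x)"
    using phi_add[OF sqbdd_finite[OF cpt insert.hyps(1) t] sqbdd_act[OF cpt unit_seq_sqbdd CX_cnj[OF t]]]
    by simp
  also have "\<dots> = (\<lambda>x. phi (restr I t) x + gen j x * cnj (t j x))"
    unfolding gen_def by (subst phi_act[OF unit_seq_sqbdd CX_cnj[OF t]]) simp
  finally show ?case
    using insert by (simp add: algebra_simps)
qed

text \<open>Self-testing as in the dual: on a truncation of \<open>gen\<close>, \<open>phi\<close>
  takes the value \<open>S\<close>, and the norm bound gives \<open>M \<le> C * sqrt M\<close> for
  the supremum \<open>M\<close> of \<open>S\<close>.\<close>

lemma gen_sqbdd: "gen \<in> sqbdd (C\<^sup>2)"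
proof (rule sqbdd_I[OF gen_CX])
  fix n x
  define S where "S y = (\<Sum>i<n. (cmod (gen i y))\<^sup>2)" for y
  define M where "M = supnorm (\<lambda>y. complex_of_real (S y))"
  have S0: "S y \<ge> 0" for y by (simp add: S_def sum_nonneg)
  have "(\<lambda>y. complex_of_real (S y)) \<in> CX"
    unfolding S_def by (intro CX_of_real continuous_on_sqsum gen_CX)
  then have SM: "S y \<le> M" for y
    using supnorm_upper[OF cpt, of "\<lambda>y. complex_of_real (S y)" y] S0[of y] by (simp add: M_def)
  have M0: "M \<ge> 0" using S0 SM order_trans by blast
  have "phi (restr {..<n} gen) = (\<lambda>y. complex_of_real (S y))"
    by (subst phi_finite[OF _ gen_CX]) (auto simp: S_def cnj_mult_self simp del: of_real_power)
  moreover have "restr {..<n} gen \<in> sqbdd M"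
  proof (rule sqbdd_I)
    fix m y
    have "(\<Sum>i<m. (cmod (restr {..<n} gen i y))\<^sup>2) \<le> S y"
      unfolding S_def by (rule sqsum_restr_le) auto
    then show "(\<Sum>i<m. (cmod (restr {..<n} gen i y))\<^sup>2) \<le> M" using SM[of y] by simp
  qed (simp add: CX_restr gen_CX)
  ultimately have "cmod (complex_of_real (S y)) \<le> C * sqrt M" for y
    using phi_bound by metis
  then have "M \<le> C * sqrt M"
    unfolding M_def by (rule supnorm_least)
  then have "sqrt M * sqrt M \<le> C * sqrt M" using M0 by simp
  then have "sqrt M \<le> C"
    using mult_right_le_imp_le[of "sqrt M" "sqrt M" C] M0 C by (cases "M = 0") auto
  then have "(sqrt M)\<^sup>2 \<le> C\<^sup>2" using M0 by (intro power_mono) auto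
  then show "(\<Sum>i<n. (cmod (gen i x))\<^sup>2) \<le> C\<^sup>2"
    using SM[of x] M0 by (simp add: S_def)
qed

end

text \<open>The square sum of \<^term>\<open>t\<close> nearly attains its supremum over \<^term>\<open>V\<close> on an open set
  where a single partial sum does, and there the tail is small.\<close>
lemma sqbdd_small_tail:
  fixes t :: "nat \<Rightarrow> 'a::topological_space \<Rightarrow> complex"
  assumes t: "t \<in> sqbdd K" and V: "open V" "V \<noteq> {}" and e: "e > 0"
  obtains n W where "open W" "W \<subseteq> V" "W \<noteq> {}"
    "\<And>z m. z \<in> W \<Longrightarrow> (\<Sum>i<m. (cmod (restr {n..} t i z))\<^sup>2) \<le> e"
proof -
  define s where "s n z = (\<Sum>i<n. (cmod (t i z))\<^sup>2)" for n z
  define A where "A = (\<lambda>(n, z). s n z) ` (UNIV \<times> V)"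
  have bdd: "bdd_above A"
    unfolding A_def s_def using sqbdd_le[OF t] by (intro bdd_aboveI2[where M=K]) auto
  have "A \<noteq> {}" using V(2) by (auto simp: A_def)
  then obtain n y where ny: "y \<in> V" "Sup A - e < s n y"
    using less_cSup_iff[OF _ bdd, of "Sup A - e"] e by (auto simp: A_def)
  define W where "W = V \<inter> {z. Sup A - e < s n z}"
  have cont: "continuous_on UNIV (s n)"
    unfolding s_def[abs_def] by (intro continuous_on_sqsum sqbdd_CX[OF t])
  have "open W"
    unfolding W_def by (intro open_Int V open_Collect_less continuous_on_const cont)
  moreover have "W \<subseteq> V" "W \<noteq> {}" using ny by (auto simp: W_def)
  moreover have "(\<Sum>i<m. (cmod (restr {n..} t i z))\<^sup>2) \<le> e" if z: "z \<in> W" for z m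
  proof -
    \<comment> \<open>Passing to \<open>max m n\<close> makes the tail sum a difference of two
      values of \<open>s\<close>, also when \<open>m < n\<close>.\<close>
    have "(\<Sum>i<m. (cmod (restr {n..} t i z))\<^sup>2) \<le> (\<Sum>i<max m n. (cmod (restr {n..} t i z))\<^sup>2)"
      by (intro sum_mono2) auto
    also have "\<dots> = (\<Sum>i=n..<max m n. (cmod (t i z))\<^sup>2)"
      by (rule sum.mono_neutral_cong_right) (auto simp: restr_def)
    also have "\<dots> = s (max m n) z - s n z"
      unfolding s_def using sum_diff_nat_ivl[of 0 n "max m n" "\<lambda>i. (cmod (t i z))\<^sup>2"]
      by (simp add: atLeast0LessThan)
    also have "s (max m n) z \<le> Sup A"
      using z bdd by (intro cSup_upper) (auto simp: A_def W_def)
    finally show ?thesis using z by (simp add: W_def)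
  qed
  ultimately show ?thesis using that by blast
qed

section \<open>Evaluation at square-summable coefficients, and extension from large blocks\<close>

context l2_bidual_elem
begin

text \<open>If the continuous difference \<open>h\<close> were nonzero, it would exceed some
  \<delta> on an open set. On a smaller open set the tail of \<open>t\<close> is small, the finite
  heads cancel exactly, and the two tail terms add up to less than \<delta>.\<close>

lemma eq_l2_hat:
  assumes a: "(\<lambda>i x. cnj (gen i x)) \<in> l2CX"
  shows "\<Phi> = l2_hat (\<lambda>i x. cnj (gen i x))"
proof
  fix T
  let ?a = "\<lambda>i x. cnj (gen i x)"
  show "\<Phi> T = l2_hat ?a T"
  proof (cases "T \<in> l2_dual")
    case False
    then show ?thesis using Phi by (auto simp: l2_bidual_def l2_hat_def)
  next
    case True
    then obtain t K where t: "t \<in> sqbdd K" "T = pairing t"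
      using l2_dual_eq_pairing[OF cpt] by blast
    define h where "h y = phi t y - cnj (pairing t ?a y)" for y
    have "h x = 0" for x
    proof (rule ccontr)
      assume hx: "h x \<noteq> 0"
      define \<delta> where "\<delta> = cmod (h x) / 2"
      have \<delta>: "\<delta> > 0" using hx by (simp add: \<delta>_def)
      define V where "V = {y. \<delta> < cmod (h y)}"
      have "continuous_on UNIV (\<lambda>y. cmod (h y))"
        using phi_CX[OF t(1)] pairing_CX[OF t(1), of ?a]
        by (auto simp: h_def CX_def intro!: continuous_intros)
      then have "open V"
        unfolding V_def by (intro open_Collect_less continuous_on_const)
      moreover have "x \<in> V" using hx by (simp add: V_def \<delta>_def)
      \<comment> \<open>The tails contribute at most \<open>r * C\<close> and
        \<open>r * l2_mnorm ?a\<close>; the extra 1 makes their sum strictly less than \<delta> and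
        the denominator positive.\<close>
      moreover define r where "r = \<delta> / (C + l2_mnorm ?a + 1)"
      have N: "0 \<le> l2_mnorm ?a" by (rule l2_mnorm_nonneg[OF cpt a])
      then have r: "r > 0" using \<delta> C by (simp add: r_def)
      ultimately obtain n W where W: "open W" "W \<subseteq> V" "W \<noteq> {}"
        and tail: "\<And>z m. z \<in> W \<Longrightarrow> (\<Sum>i<m. (cmod (restr {n..} t i z))\<^sup>2) \<le> r\<^sup>2"
        using sqbdd_small_tail[OF t(1), of V "r\<^sup>2"] by (metis empty_iff zero_less_power)
      then obtain y where y: "y \<in> W" by blast
      have split: "t = (\<lambda>i x. restr {..<n} t i x + restr {n..} t i x)"
        by (auto simp: restr_def fun_eq_iff)
      have tl: "restr {n..} t \<in> sqbdd K" and hd: "restr {..<n} t \<in> sqbdd K"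
        by (rule sqbdd_restr[OF t(1)])+
      have "phi t y = (\<Sum>i<n. cnj (t i y) * gen i y) + phi (restr {n..} t) y"
        using phi_add[OF hd tl] phi_finite[of "{..<n}" t, OF _ sqbdd_CX[OF t(1)]] split by simp
      moreover have "pairing t ?a y = (\<Sum>i<n. t i y * ?a i y) + pairing (restr {n..} t) ?a y"
      proof -
        have "(\<lambda>i. if i \<in> {..<n} then t i y * ?a i y else 0) sums (\<Sum>i<n. t i y * ?a i y)"
          by (rule sums_If_finite_set) simp
        moreover have "(\<lambda>i. if i \<in> {..<n} then t i y * ?a i y else 0) = (\<lambda>i. restr {..<n} t i y * ?a i y)"
          by (auto simp: restr_def)
        ultimately have "pairing (restr {..<n} t) ?a y = (\<Sum>i<n. t i y * ?a i y)"
          using pairing_tendsto[OF hd a, of y] sums_unique2 by metis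
        then show ?thesis
          using pairing_add[OF hd tl] split by simp
      qed
      ultimately have "h y = phi (restr {n..} t) y - cnj (pairing (restr {n..} t) ?a y)"
        by (simp add: h_def)
      then have "cmod (h y) \<le> cmod (phi (restr {n..} t) y) + cmod (pairing (restr {n..} t) ?a y)"
        using norm_triangle_ineq4[of "phi (restr {n..} t) y" "cnj (pairing (restr {n..} t) ?a y)"] by simp
      also have "\<dots> \<le> C * sqrt (r\<^sup>2) + sqrt (r\<^sup>2) * l2_mnorm ?a"
        by (intro add_mono phi_local[OF tl W(1) y tail] cmod_pairing_le[OF cpt tl a tail] y)
      also have "\<dots> = r * (C + l2_mnorm ?a)"
        using r by (simp add: algebra_simps)
      also have "\<dots> < r * (C + l2_mnorm ?a + 1)"
        using r by simp
      also have "\<dots> = \<delta>" using C N by (simp add: r_def)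
      finally show False using y W(2) by (auto simp: V_def)
    qed
    then show ?thesis
      using True by (simp add: t(2) h_def phi_def l2_hat_def fun_eq_iff)
  qed
qed

text \<open>The functional built from \<^term>\<open>lam\<close> has coefficients
  \<open>cnj lam * gen / \<Sum>|gen|\<^sup>2\<close> on the block \<^term>\<open>B j\<close>, so that the value of \<^term>\<open>phi\<close> on it is
  \<^term>\<open>lam j\<close> on \<^term>\<open>U j\<close>.\<close>
lemma prod_canon_included_blocks:
  assumes fin: "\<And>j. finite (B j)" and disjB: "\<And>j k. j \<noteq> k \<Longrightarrow> B j \<inter> B k = {}"
    and opU: "\<And>j. open (U j)" and disjU: "\<And>j k. j \<noteq> k \<Longrightarrow> U j \<inter> U k = {}" and e: "e > 0"
    and large: "\<And>j x. x \<in> U j \<Longrightarrow> e \<le> (\<Sum>i\<in>B j. (cmod (gen i x))\<^sup>2)"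
  shows "prod_canon_included U"
  unfolding prod_canon_included_def
proof (intro allI impI)
  fix lam :: "nat \<Rightarrow> 'a \<Rightarrow> complex"
  assume "(\<forall>k. lam k \<in> C0 (U k)) \<and> (\<exists>D. \<forall>k x. cmod (lam k x) \<le> D)"
  then obtain D where lamC: "\<And>k. lam k \<in> CX" and lam0: "\<And>k x. x \<notin> U k \<Longrightarrow> lam k x = 0"
    and D: "\<And>k x. cmod (lam k x) \<le> D"
    by (auto simp: C0_def)
  define F where "F j x = (\<Sum>i\<in>B j. (cmod (gen i x))\<^sup>2)" for j x
  \<comment> \<open>The maximum keeps the denominator at least \<open>e\<close> everywhere and
    equals \<open>F j\<close> on \<open>U j\<close>; \<open>lam j\<close> is conjugated because
    \<open>phi\<close> conjugates coefficients.\<close>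
  define u where "u j i x = cnj (lam j x) * gen i x * complex_of_real (inverse (max (F j x) e))" for j i x
  \<comment> \<open>The blocks are disjoint, so the choice of \<open>j\<close> is forced; indices in
    no block get coefficient 0.\<close>
  define t where "t i = (if \<exists>j. i \<in> B j then u (SOME j. i \<in> B j) i else (\<lambda>x. 0))" for i
  have t_in: "t i = u j i" if "i \<in> B j" for i j
  proof -
    have "(SOME j. i \<in> B j) = j"
      using that disjB by (intro some_equality) blast+
    then show ?thesis using that by (auto simp: t_def)
  qed
  have uC: "u j i \<in> CX" for i j
  proof -
    have "continuous_on UNIV (\<lambda>x. max (F j x) e)"
      unfolding F_def by (intro continuous_on_max continuous_on_sqsum gen_CX continuous_on_const)
    moreover have "max (F j x) e \<noteq> 0" for x using e by linarith
    ultimately have "continuous_on UNIV (\<lambda>x. inverse (max (F j x) e))"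
      by (intro continuous_on_inverse) auto
    then show ?thesis
      unfolding u_def by (intro CX_mult CX_cnj lamC gen_CX CX_of_real)
  qed
  have tC: "t i \<in> CX" for i
    using uC by (auto simp: t_def CX_const)
  have outside: "t i x = 0" if "\<And>j. i \<in> B j \<Longrightarrow> x \<notin> U j" for i x
  proof (cases "\<exists>j. i \<in> B j")
    case True
    then obtain j where "i \<in> B j" by blast
    then show ?thesis using t_in[of i j] lam0 that by (simp add: u_def)
  qed (simp add: t_def)
  \<comment> \<open>On \<open>U j\<close> the functions \<open>lam k\<close> of all other blocks
    vanish.\<close>
  have inside: "t i x = restr (B j) t i x" if "x \<in> U j" for i j x
  proof (cases "i \<in> B j")
    case False
    then have "t i x = 0"
      using that disjU by (intro outside) (metis disjoint_iff)
    then show ?thesis by (simp add: restr_def)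
  qed (simp add: restr_def)
  have D0: "0 \<le> D" by (rule order_trans[OF norm_ge_zero D])
  have t: "t \<in> sqbdd (D\<^sup>2 / e)"
  proof (rule sqbdd_I[OF tC])
    fix n x
    show "(\<Sum>i<n. (cmod (t i x))\<^sup>2) \<le> D\<^sup>2 / e"
    proof (cases "\<exists>j. x \<in> U j")
      case False
      then have "(\<Sum>i<n. (cmod (t i x))\<^sup>2) = 0" using outside by (intro sum.neutral) auto
      then show ?thesis using e by simp
    next
      case True
      then obtain j where j: "x \<in> U j" by blast
      have Fe: "e \<le> F j x" using large[OF j] by (simp add: F_def)
      have "(\<Sum>i<n. (cmod (t i x))\<^sup>2) \<le> (\<Sum>i\<in>B j. (cmod (t i x))\<^sup>2)"
        using sqsum_restr_le[OF fin[of j], where n=n and t=t and x=x] inside[OF j] by simp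
      also have "\<dots> = (\<Sum>i\<in>B j. (cmod (lam j x))\<^sup>2 * (cmod (gen i x))\<^sup>2 * (inverse (F j x))\<^sup>2)"
        using Fe e by (intro sum.cong) (auto simp: t_in u_def norm_mult power_mult_distrib max_def norm_inverse)
      also have "\<dots> = (cmod (lam j x))\<^sup>2 * F j x * (inverse (F j x))\<^sup>2"
        unfolding F_def by (simp add: sum_distrib_left sum_distrib_right mult.assoc)
      \<comment> \<open>Normalising by the block sum leaves one factor \<open>F j x\<close> below,
        which is at least \<open>e\<close> on \<open>U j\<close>.\<close>
      also have "\<dots> = (cmod (lam j x))\<^sup>2 / F j x"
        using Fe e by (simp add: power2_eq_square field_simps)
      also have "\<dots> \<le> D\<^sup>2 / e"
        using Fe e D0 D by (intro frac_le power_mono) auto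
      finally show ?thesis .
    qed
  qed
  have "phi t x = lam j x" if x: "x \<in> U j" for j x
  proof -
    \<comment> \<open>Off the block \<open>B j\<close> the coefficients vanish on the open set
      \<open>U j\<close>, so by locality only the finite block contributes.\<close>
    have "phi t = (\<lambda>x. phi (restr (B j) t) x + phi (restr (- B j) t) x)"
      using phi_add[OF sqbdd_restr[OF t, of "B j"] sqbdd_restr[OF t, of "- B j"]]
      by (simp add: restr_def if_distrib[of "\<lambda>z. z + _"] cong: if_cong)
    moreover have "phi (restr (- B j) t) x = 0"
    proof (rule phi_local_zero[OF sqbdd_restr[OF t] opU x])
      fix y i
      assume "y \<in> U j"
      then show "restr (- B j) t i y = 0"
        using inside[of y j i] by (auto simp: restr_def split: if_splits)
    qed
    moreover have "phi (restr (B j) t) x = lam j x"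
    proof -
      have Fe: "e \<le> F j x" using large[OF x] by (simp add: F_def)
      have "phi (restr (B j) t) x = (\<Sum>i\<in>B j. cnj (t i x) * gen i x)"
        by (simp add: phi_finite[OF fin tC])
      also have "\<dots> = (\<Sum>i\<in>B j. lam j x * complex_of_real (inverse (F j x)) * complex_of_real ((cmod (gen i x))\<^sup>2))"
        using Fe by (intro sum.cong)
          (auto simp: t_in u_def max_def cnj_mult_self[symmetric] simp del: of_real_power)
      also have "\<dots> = lam j x * complex_of_real (inverse (F j x)) * complex_of_real (F j x)"
        unfolding F_def by (simp add: sum_distrib_left)
      also have "\<dots> = lam j x" using Fe e by simp
      finally show ?thesis .
    qed
    ultimately show ?thesis by simp
  qed
  moreover have "phi t x = 0" if x: "x \<notin> closure (\<Union>k. U k)" for x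
  proof (rule phi_local_zero[OF t])
    show "open (- closure (\<Union>k. U k))" by (intro open_Compl closed_closure)
    fix y i
    assume "y \<in> - closure (\<Union>k. U k)"
    then have "y \<notin> U j" for j using closure_subset[of "\<Union>k. U k"] by auto
    then show "t i y = 0" by (rule outside)
  qed (use x in simp)
  ultimately show "\<exists>f\<in>CX. (\<forall>k. \<forall>x\<in>U k. f x = lam k x) \<and> (\<forall>x. x \<notin> closure (\<Union>k. U k) \<longrightarrow> f x = 0)"
    using phi_CX[OF t] by blast
qed

end

lemma l2_bidual_elemI:
  fixes \<Phi> :: "((nat \<Rightarrow> 'a::t2_space \<Rightarrow> complex) \<Rightarrow> 'a \<Rightarrow> complex) \<Rightarrow> 'a \<Rightarrow> complex"
  assumes c: "compact (UNIV :: 'a set)" and Phi: "\<Phi> \<in> l2_bidual"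
  obtains C where "l2_bidual_elem \<Phi> C"
proof -
  obtain C where C: "\<And>T. T \<in> l2_dual \<Longrightarrow> supnorm (\<Phi> T) \<le> C * dual_norm T"
    using Phi unfolding l2_bidual_def by blast
  have "supnorm (\<Phi> T) \<le> \<bar>C\<bar> * dual_norm T" if "T \<in> l2_dual" for T
    using C[OF that] dual_norm_nonneg[OF c that]
    by (meson abs_ge_self mult_right_mono order_trans)
  then have "l2_bidual_elem \<Phi> \<bar>C\<bar>"
    using c Phi by unfold_locales auto
  then show ?thesis by (rule that)
qed

subsection \<open>Extraction of disjoint open sets\<close>

text \<open>Failure of the Cauchy criterion gives one \<open>e\<close> and, beyond every index, a
  block reaching \<open>e\<close> at some point.\<close>

lemma blocks_of_not_l2CX:
  assumes "\<And>i. g i \<in> CX" "g \<notin> l2CX"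
  shows "\<exists>e>0. \<exists>B :: nat \<Rightarrow> nat set. (\<forall>k. finite (B k)) \<and> (\<forall>j k. j \<noteq> k \<longrightarrow> B j \<inter> B k = {}) \<and>
    (\<forall>k. \<exists>x. e \<le> (\<Sum>i\<in>B k. (cmod (g i x))\<^sup>2))"
proof -
  obtain e where e: "e > 0"
    and "\<And>N. \<exists>m\<ge>N. \<exists>n\<ge>m. \<exists>x. e \<le> (\<Sum>i=m..<n. (cmod (g i x))\<^sup>2)"
    using assms unfolding l2CX_iff by (force simp: not_less)
  have "\<exists>n>N. \<exists>x. e \<le> (\<Sum>i=N..<n. (cmod (g i x))\<^sup>2)" for N
  proof -
    obtain m n x where mn: "m \<ge> N" "n \<ge> m" "e \<le> (\<Sum>i=m..<n. (cmod (g i x))\<^sup>2)"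
      using \<open>\<And>N. \<exists>m\<ge>N. \<exists>n\<ge>m. \<exists>x. e \<le> (\<Sum>i=m..<n. (cmod (g i x))\<^sup>2)\<close> by blast
    have "(\<Sum>i=m..<n. (cmod (g i x))\<^sup>2) \<le> (\<Sum>i=N..<n. (cmod (g i x))\<^sup>2)"
      using mn(1) by (intro sum_mono2) auto
    \<comment> \<open>An empty sum cannot reach \<open>e > 0\<close>; hence the next endpoint is
      strictly larger.\<close>
    moreover have "n \<noteq> m" using mn(3) e by auto
    ultimately show ?thesis using mn by (intro exI[of _ n]) (auto intro: order_trans)
  qed
  then obtain nxt where nxt: "\<And>N. nxt N > N" "\<And>N. \<exists>x. e \<le> (\<Sum>i=N..<nxt N. (cmod (g i x))\<^sup>2)"
    by metis
  \<comment> \<open>Iterating \<open>nxt\<close> from 0 gives the endpoints of consecutive, hence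
    disjoint, intervals.\<close>
  define p where "p k = (nxt ^^ k) 0" for k
  have p_Suc: "p (Suc k) = nxt (p k)" for k by (simp add: p_def)
  have mono: "mono p"
    by (rule monoI, rule lift_Suc_mono_le[of p]) (auto simp: p_Suc nxt(1) less_imp_le)
  have lt: "{p j..<p (Suc j)} \<inter> {p k..<p (Suc k)} = {}" if "j < k" for j k
    using monoD[OF mono, of "Suc j" k] that by auto
  show ?thesis
  proof (intro exI[of _ e] exI[of _ "\<lambda>k. {p k..<p (Suc k)}"] conjI allI impI)
    fix j k :: nat
    assume "j \<noteq> k"
    then show "{p j..<p (Suc j)} \<inter> {p k..<p (Suc k)} = {}"
      using lt[of j k] lt[of k j] by (metis Int_commute linorder_neqE_nat)
  qed (use e nxt(2) p_Suc in auto)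
qed

text \<open>Finitely many disjoint blocks fit inside one partial sum. This limits how many blocks
  can be large at the same point.\<close>

lemma sum_blocks_le:
  fixes B :: "nat \<Rightarrow> nat set"
  assumes g: "g \<in> sqbdd K" and "finite S" and fin: "\<And>k. finite (B k)"
    and disj: "\<And>j k. j \<noteq> k \<Longrightarrow> B j \<inter> B k = {}"
  shows "(\<Sum>k\<in>S. \<Sum>i\<in>B k. (cmod (g i x))\<^sup>2) \<le> K"
proof -
  have "finite (\<Union>k\<in>S. B k)" using assms by blast
  then obtain n where n: "(\<Union>k\<in>S. B k) \<subseteq> {..<n}"
    using finite_nat_iff_bounded by blast
  have "(\<Sum>k\<in>S. \<Sum>i\<in>B k. (cmod (g i x))\<^sup>2) = (\<Sum>i\<in>(\<Union>k\<in>S. B k). (cmod (g i x))\<^sup>2)"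
    using assms by (subst sum.UNION_disjoint) auto
  also have "\<dots> \<le> (\<Sum>i<n. (cmod (g i x))\<^sup>2)"
    using n by (intro sum_mono2) auto
  also have "\<dots> \<le> K" by (rule sqbdd_le[OF g])
  finally show ?thesis .
qed

text \<open>A maximal finite intersection of the \<^term>\<open>V k\<close> is disjoint from every other member;
  each index lies in one such maximal index set, and these are finite.\<close>
lemma disjoint_refinement:
  fixes V :: "nat \<Rightarrow> 'a::topological_space set"
  assumes opV: "\<And>k. open (V k)" and neV: "\<And>k. V k \<noteq> {}"
    and overlap: "\<And>S. finite S \<Longrightarrow> (\<Inter>k\<in>S. V k) \<noteq> {} \<Longrightarrow> card S \<le> N"
  obtains \<kappa> :: "nat \<Rightarrow> nat" and U where "inj \<kappa>" "\<And>j. open (U j)" "\<And>j. U j \<noteq> {}"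
    "\<And>j. U j \<subseteq> V (\<kappa> j)" "\<And>j k. j \<noteq> k \<Longrightarrow> U j \<inter> U k = {}"
proof -
  have "\<exists>S. finite S \<and> k \<in> S \<and> (\<Inter>l\<in>S. V l) \<noteq> {} \<and> (\<forall>l. l \<notin> S \<longrightarrow> V l \<inter> (\<Inter>l\<in>S. V l) = {})" for k
  proof -
    let ?P = "\<lambda>S. finite S \<and> k \<in> S \<and> (\<Inter>l\<in>S. V l) \<noteq> {}"
    have "?P {k}" using neV by simp
    \<comment> \<open>\<open>overlap\<close> bounds the size of admissible index sets, so one of
      greatest size exists; \<open>Suc N\<close> makes the bound strict.\<close>
    moreover have "\<forall>S. ?P S \<longrightarrow> card S < Suc N" using overlap by (auto simp: less_Suc_eq_le)
    ultimately obtain S where S: "?P S" "\<And>S'. ?P S' \<Longrightarrow> card S' \<le> card S"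
      using ex_has_greatest_nat[of ?P "{k}" card "Suc N"] by (metis (no_types, lifting))
    have "V l \<inter> (\<Inter>l\<in>S. V l) = {}" if "l \<notin> S" for l
    proof (rule ccontr)
      assume "V l \<inter> (\<Inter>l\<in>S. V l) \<noteq> {}"
      then have "?P (insert l S)" using S(1) by auto
      then have "card (insert l S) \<le> card S" by (rule S(2))
      then show False using S(1) that by simp
    qed
    then show ?thesis using S(1) by blast
  qed
  then obtain M where M: "\<And>k. finite (M k)" "\<And>k. k \<in> M k" "\<And>k. (\<Inter>l\<in>M k. V l) \<noteq> {}"
    "\<And>k l. l \<notin> M k \<Longrightarrow> V l \<inter> (\<Inter>l\<in>M k. V l) = {}"
    by metis
  have "\<exists>\<kappa>. \<forall>j::nat. \<kappa> j \<notin> (\<Union>i<j. M (\<kappa> i))"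
  \<comment> \<open>Greedy choice: the maximal sets of the earlier indices form a finite union, so
    an index outside it remains.\<close>
  proof (rule dependent_wellorder_choice[where P="\<lambda>f j r. r \<notin> (\<Union>i<j. M (f i))"])
    fix j :: nat and f :: "nat \<Rightarrow> nat"
    show "\<exists>r. r \<notin> (\<Union>i<j. M (f i))"
      using M(1) by (intro ex_new_if_finite infinite_UNIV_nat) auto
  qed auto
  then obtain \<kappa> where "\<forall>j::nat. \<kappa> j \<notin> (\<Union>i<j. M (\<kappa> i))" ..
  then have \<kappa>: "\<kappa> j \<notin> M (\<kappa> i)" if "i < j" for i j
    using that by auto
  define U where "U j = (\<Inter>l\<in>M (\<kappa> j). V l)" for j
  have sub: "U j \<subseteq> V (\<kappa> j)" for j using M(2) by (auto simp: U_def)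
  \<comment> \<open>The later index lies outside the maximal set of the earlier one, so
    \<open>V (\<kappa> j)\<close> misses \<open>U i\<close>.\<close>
  have lt: "U i \<inter> U j = {}" if "i < j" for i j
    using M(4)[OF \<kappa>[OF that]] sub[of j] by (auto simp: U_def)
  show ?thesis
  proof (rule that[of \<kappa> U])
    show "inj \<kappa>"
      using \<kappa> M(2) by (metis injI linorder_neqE_nat)
    show "open (U j)" for j
      unfolding U_def using M(1) opV by blast
    show "U j \<inter> U k = {}" if "j \<noteq> k" for j k
      using lt[of j k] lt[of k j] that by (metis Int_commute linorder_neqE_nat)
  qed (use sub M(3) in \<open>auto simp: U_def\<close>)
qed

lemma not_reflexive_imp_disjoint_open:
  assumes c: "compact (UNIV :: 'a::t2_space set)" and "\<not> l2CX_reflexive TYPE('a)"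
  obtains U :: "nat \<Rightarrow> 'a::t2_space set" where "\<And>k. open (U k)" "\<And>k. U k \<noteq> {}"
    "\<And>j k. j \<noteq> k \<Longrightarrow> U j \<inter> U k = {}" "prod_canon_included U"
proof -
  \<comment> \<open>Evaluations always lie in the bidual, so failure of reflexivity yields an
    element that is not one.\<close>
  obtain \<Phi> :: "((nat \<Rightarrow> 'a \<Rightarrow> complex) \<Rightarrow> 'a \<Rightarrow> complex) \<Rightarrow> 'a \<Rightarrow> complex"
    where \<Phi>: "\<Phi> \<in> l2_bidual" "\<Phi> \<notin> l2_hat ` l2CX"
    using assms(2) l2_hat_in_bidual[OF c] unfolding l2CX_reflexive_def by blast
  obtain C where "l2_bidual_elem \<Phi> C"
    using l2_bidual_elemI[OF c \<Phi>(1)] by blast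
  then interpret l2_bidual_elem \<Phi> C .
  \<comment> \<open>Conjugation preserves squared moduli, so otherwise \<open>eq_l2_hat\<close>
    would make \<Phi> an evaluation.\<close>
  have "gen \<notin> l2CX"
    using eq_l2_hat \<Phi>(2) by (auto simp: l2CX_iff CX_cnj gen_CX)
  from blocks_of_not_l2CX[OF gen_CX this] obtain e and B :: "nat \<Rightarrow> nat set" where e: "e > 0"
    and "\<forall>k. finite (B k)" "\<forall>j k. j \<noteq> k \<longrightarrow> B j \<inter> B k = {}"
      "\<forall>k. \<exists>x. e \<le> (\<Sum>i\<in>B k. (cmod (gen i x))\<^sup>2)"
    by (elim exE conjE) blast
  then have fin: "finite (B k)" and disjB: "j \<noteq> k \<Longrightarrow> B j \<inter> B k = {}"
    and large: "\<exists>x. e \<le> (\<Sum>i\<in>B k. (cmod (gen i x))\<^sup>2)" for j k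
    by simp_all
  define F where "F k x = (\<Sum>i\<in>B k. (cmod (gen i x))\<^sup>2)" for k x
  \<comment> \<open>Halving \<open>e\<close> gives a strict, hence open, condition that still holds
    wherever a block sum reaches \<open>e\<close>.\<close>
  define V where "V k = {x. e / 2 < F k x}" for k
  have "open (V k)" for k
    unfolding V_def F_def by (intro open_Collect_less continuous_on_const continuous_on_sqsum gen_CX)
  moreover have "V k \<noteq> {}" for k
  proof -
    obtain x where "e \<le> F k x" using large[of k] by (auto simp: F_def)
    then have "x \<in> V k" using e by (simp add: V_def)
    then show ?thesis by blast
  qed
  \<comment> \<open>At a common point each block sum exceeds \<open>e / 2\<close>, while their total
    is at most the bound on the square sums of \<open>gen\<close>.\<close>
  moreover have "card S \<le> nat \<lceil>2 * C\<^sup>2 / e\<rceil>" if S: "finite S" "(\<Inter>k\<in>S. V k) \<noteq> {}" for S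
  proof -
    obtain x where x: "\<And>k. k \<in> S \<Longrightarrow> x \<in> V k" using S(2) by blast
    have "real (card S) * (e / 2) \<le> (\<Sum>k\<in>S. F k x)"
      using x by (intro sum_bounded_below) (force simp: V_def)
    also have "\<dots> \<le> C\<^sup>2"
      unfolding F_def by (rule sum_blocks_le[OF gen_sqbdd S(1) fin disjB])
    finally have "real (card S) \<le> 2 * C\<^sup>2 / e" using e by (simp add: field_simps)
    then show ?thesis by linarith
  qed
  ultimately obtain \<kappa> :: "nat \<Rightarrow> nat" and U where \<kappa>: "inj \<kappa>" and U: "\<And>j. open (U j)" "\<And>j. U j \<noteq> {}"
    "\<And>j. U j \<subseteq> V (\<kappa> j)" "\<And>j k. j \<noteq> k \<Longrightarrow> U j \<inter> U k = {}"
    by (rule disjoint_refinement[of V]) (assumption | blast)+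
  have "prod_canon_included U"
  proof (rule prod_canon_included_blocks[of "\<lambda>j. B (\<kappa> j)" U "e / 2"])
    show "B (\<kappa> j) \<inter> B (\<kappa> k) = {}" if "j \<noteq> k" for j k
      using disjB \<kappa> that by (simp add: inj_eq)
    show "e / 2 \<le> (\<Sum>i\<in>B (\<kappa> j). (cmod (gen i x))\<^sup>2)" if "x \<in> U j" for j x
      using U(3)[of j] that by (auto simp: V_def F_def)
  qed (use fin U e in auto)
  then show ?thesis using that U by blast
qed

subsection \<open>Non-reflexivity from an included product\<close>

text \<open>The set where \<open>f\<close> and \<open>g\<close> agree is closed and contains the
  union, hence its closure. Uniqueness is what makes the choice of extensions additive and module
  linear.\<close>

lemma canon_extension_unique:
  fixes f g :: "'a::topological_space \<Rightarrow> complex"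
  assumes "f \<in> CX" "g \<in> CX" and eq: "\<And>k x. x \<in> U k \<Longrightarrow> f x = g x"
    and out: "\<And>x. x \<notin> closure (\<Union>k. U k) \<Longrightarrow> f x = g x"
  shows "f = g"
proof
  fix x
  have "closed {x. f x = g x}"
    using assms(1,2) by (intro closed_Collect_eq) (auto simp: CX_def)
  then have "closure (\<Union>k. U k) \<subseteq> {x. f x = g x}"
    by (intro closure_minimal) (use eq in auto)
  then show "f x = g x" using out by blast
qed

lemma included_imp_not_reflexive:
  fixes U :: "nat \<Rightarrow> 'a::t2_space set"
  assumes c: "compact (UNIV :: 'a set)" and op: "\<And>k. open (U k)" and ne: "\<And>k. U k \<noteq> {}"
    and incl: "prod_canon_included U"
  shows "\<not> l2CX_reflexive TYPE('a)"
proof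
  assume refl: "l2CX_reflexive TYPE('a)"
  have "\<exists>y. y \<in> U k" for k using ne by auto
  then obtain p where p: "\<And>k. p k \<in> U k" by metis
  have "\<exists>l. l \<in> C0 (U k) \<and> (\<forall>y. cmod (l y) \<le> 1) \<and> l (p k) = 1" for k
  proof -
    obtain l :: "'a \<Rightarrow> real" where l: "continuous_on UNIV l" "\<And>y. 0 \<le> l y" "\<And>y. l y \<le> 1"
      "l (p k) = 1" "\<And>y. y \<notin> U k \<Longrightarrow> l y = 0"
      using urysohn_bump[OF c op p] by blast
    then show ?thesis
      by (intro exI[of _ "\<lambda>y. complex_of_real (l y)"]) (auto simp: C0_def CX_of_real)
  qed
  then obtain lam where lam: "\<And>k. lam k \<in> C0 (U k)" "\<And>k y. cmod (lam k y) \<le> 1" "\<And>k. lam k (p k) = 1"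
    by metis
  \<comment> \<open>The coordinate of \<open>T\<close> is conjugated to undo the conjugation in
    \<open>dual_act\<close>, so that the extension is right linear in \<open>T\<close>.\<close>
  define ext where "ext T f \<longleftrightarrow> f \<in> CX \<and> (\<forall>k. \<forall>x\<in>U k. f x = lam k x * cnj (T (unit_seq k) x)) \<and>
    (\<forall>x. x \<notin> closure (\<Union>k. U k) \<longrightarrow> f x = 0)" for T :: "(nat \<Rightarrow> 'a \<Rightarrow> complex) \<Rightarrow> 'a \<Rightarrow> complex" and f
  have ext_unique: "f = g" if "ext T f" "ext T g" for T f g
    by (rule canon_extension_unique[of f g U]) (use that in \<open>auto simp: ext_def\<close>)
  \<comment> \<open>This bound serves twice: for the existence of the extension and for its
    norm.\<close>
  have coef: "cmod (lam k x * cnj (T (unit_seq k) x)) \<le> dual_norm T" if T: "T \<in> l2_dual" for k x T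
  proof -
    have "cmod (T (unit_seq k) x) \<le> dual_norm T"
      using supnorm_upper[OF c l2_dual_CX[OF T]]
        supnorm_le_dual_norm[OF c T unit_seq_l2CX l2_mnorm_unit_seq] by (rule order_trans)
    then have "cmod (lam k x) * cmod (T (unit_seq k) x) \<le> 1 * dual_norm T"
      by (intro mult_mono lam) auto
    then show ?thesis by (simp add: norm_mult)
  qed
  have "\<exists>f. ext T f" if T: "T \<in> l2_dual" for T
  proof -
    have "(\<lambda>x. lam k x * cnj (T (unit_seq k) x)) \<in> C0 (U k)" for k
      using lam(1)[of k] by (auto simp: C0_def intro!: CX_mult CX_cnj l2_dual_CX[OF T])
    moreover have "\<exists>B. \<forall>k x. cmod (lam k x * cnj (T (unit_seq k) x)) \<le> B"
      using coef[OF T] by blast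
    ultimately show ?thesis
      using incl[unfolded prod_canon_included_def, rule_format, of "\<lambda>k x. lam k x * cnj (T (unit_seq k) x)"]
      unfolding ext_def by blast
  qed
  then obtain E where E: "\<And>T. T \<in> l2_dual \<Longrightarrow> ext T (E T)" by metis
  define \<Phi> where "\<Phi> T = (if T \<in> l2_dual then E T else (\<lambda>x. 0))" for T
  have "\<Phi> \<in> l2_bidual"
    unfolding l2_bidual_def
  proof (intro CollectI conjI ballI allI impI)
    fix T S :: "(nat \<Rightarrow> 'a \<Rightarrow> complex) \<Rightarrow> 'a \<Rightarrow> complex"
    assume T: "T \<in> l2_dual" and S: "S \<in> l2_dual"
    have TS: "(\<lambda>a x. T a x + S a x) \<in> l2_dual" by (rule l2_dual_closed_add[OF c T S])
    have "ext (\<lambda>a x. T a x + S a x) (\<lambda>x. E T x + E S x)"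
      using E[OF T] E[OF S] by (auto simp: ext_def CX_add algebra_simps)
    then show "\<Phi> (\<lambda>a x. T a x + S a x) = (\<lambda>x. \<Phi> T x + \<Phi> S x)"
      using ext_unique[OF E[OF TS]] T S TS by (simp add: \<Phi>_def)
  next
    fix T :: "(nat \<Rightarrow> 'a \<Rightarrow> complex) \<Rightarrow> 'a \<Rightarrow> complex" and l :: "'a \<Rightarrow> complex"
    assume T: "T \<in> l2_dual" and l: "l \<in> CX"
    have Tl: "dual_act T l \<in> l2_dual" by (rule l2_dual_closed_act[OF c T l])
    have "ext (dual_act T l) (\<lambda>x. E T x * l x)"
      using E[OF T] l by (auto simp: ext_def CX_mult dual_act_def algebra_simps)
    then show "\<Phi> (dual_act T l) = (\<lambda>x. \<Phi> T x * l x)"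
      using ext_unique[OF E[OF Tl]] T Tl by (simp add: \<Phi>_def)
  next
    have "supnorm (\<Phi> T) \<le> 1 * dual_norm T" if T: "T \<in> l2_dual" for T
    proof (rule supnorm_least)
      fix x
      \<comment> \<open>The estimate passes from the union to its closure by continuity; elsewhere
        the extension is 0.\<close>
      have "closed {x. cmod (E T x) \<le> dual_norm T}"
        using E[OF T] by (intro closed_Collect_le continuous_intros) (auto simp: ext_def CX_def)
      moreover have "(\<Union>k. U k) \<subseteq> {x. cmod (E T x) \<le> dual_norm T}"
        using E[OF T] coef[OF T] by (auto simp: ext_def)
      ultimately have "closure (\<Union>k. U k) \<subseteq> {x. cmod (E T x) \<le> dual_norm T}"
        by (rule closure_minimal[rotated])
      then have "cmod (E T x) \<le> dual_norm T"
        using E[OF T] dual_norm_nonneg[OF c T] by (cases "x \<in> closure (\<Union>k. U k)") (auto simp: ext_def)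
      then show "cmod (\<Phi> T x) \<le> 1 * dual_norm T" using T by (simp add: \<Phi>_def)
    qed
    then show "\<exists>C. \<forall>T\<in>l2_dual. supnorm (\<Phi> T) \<le> C * dual_norm T" by blast
  qed (use E in \<open>auto simp: \<Phi>_def ext_def\<close>)
  then obtain a where a: "a \<in> l2CX" "\<Phi> = l2_hat a"
    using refl unfolding l2CX_reflexive_def by blast
  \<comment> \<open>On the k-th coordinate functional \<Phi> gives \<open>lam k\<close>, which is 1
    at \<open>p k\<close>, while evaluation at \<open>a\<close> gives the conjugate of
    \<open>a k\<close>.\<close>
  have "cmod (a k (p k)) = 1" for k
  proof -
    let ?T = "pairing (unit_seq k) :: (nat \<Rightarrow> 'a \<Rightarrow> complex) \<Rightarrow> 'a \<Rightarrow> complex"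
    have T: "?T \<in> l2_dual" by (rule pairing_in_dual[OF c unit_seq_sqbdd])
    have "\<Phi> ?T (p k) = lam k (p k) * cnj (?T (unit_seq k) (p k))"
      using E[OF T] T p by (simp add: \<Phi>_def ext_def)
    then have "\<Phi> ?T (p k) = 1"
      using lam(3) by (simp add: pairing_unit_seq unit_seq_l2CX) (simp add: unit_seq_def)
    moreover have "\<Phi> ?T (p k) = cnj (a k (p k))"
      using T a by (simp add: l2_hat_def pairing_unit_seq)
    ultimately show ?thesis by (metis complex_mod_cnj norm_one)
  qed
  moreover obtain N where "\<And>m n x. m \<ge> N \<Longrightarrow> (\<Sum>i=m..<n. (cmod (a i x))\<^sup>2) < 1"
    using l2CX_tail[OF a(1), of 1] by auto
  \<comment> \<open>A block of length one, taken at \<open>p N\<close>, is a single term equal to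
    1.\<close>
  then have "(\<Sum>i=N..<Suc N. (cmod (a i (p N)))\<^sup>2) < 1" by blast
  ultimately show False by simp
qed

theorem theorem5p5:
  assumes "compact (UNIV :: 'a::t2_space set)"
  shows "\<not> l2CX_reflexive TYPE('a) \<longleftrightarrow>
    (\<exists>U :: nat \<Rightarrow> 'a set. (\<forall>k. open (U k) \<and> U k \<noteq> {}) \<and>
        (\<forall>j k. j \<noteq> k \<longrightarrow> U j \<inter> U k = {}) \<and> prod_canon_included U)"
  using not_reflexive_imp_disjoint_open[OF assms] included_imp_not_reflexive[OF assms]
  by (metis (no_types, lifting))

end
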